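(* Let $u$ be the solution of the abstract wave equation and $u_h:[0,T]\to V_h$ the solution of its semi-discretisation described in the context. Define the defect $d_h:[0,T]\to V_h$ by $$m_h(\widetilde R_h\ddot u,v_h)+b_h(\widetilde R_h\dot u,v_h)+a_h(\widetilde R_hu,v_h)=m_h(\widetilde I_hf,v_h)+m_h(d_h,v_h)\qquad\text{for all }v_h\in V_h .$$ Then, for $0\le t\le T$, $$|u(t)-u_h^\ell(t)|\le|u(t)-R_hu(t)|+C\,e^{\widehat\rho T}\Big(\varepsilon_0^2+T\int_0^t\|d_h(s)\|_{\star,h}^2\,ds\Big)^{1/2},$$ where $$\begin{aligned}\varepsilon_0={}&|I_hu_1-u_1|+|I_hu_0-u_0|+|R_hu_1-u_1|+|R_hu_0-u_0|\\&+\|\Delta b(\widetilde R_hu_0-u_0^{-\ell},\cdot)\|_{\star,h}+\|\Delta b(\widetilde I_hu_0-u_0^{-\ell},\cdot)\|_{\star,h}\\&+c\,\|B(R_hu_0-u_0)\|_\star+c\,\|B(I_hu_0-u_0)\|_\star,\end{aligned}$$ with constants $C,c>0$ independent of $h$.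
   Context: **Continuous problem.** $V,H$ are real Hilbert spaces, $V$ densely and continuously embedded in $H$; $H$ has inner product $m(\cdot,\cdot)$ and norm $|\cdot|$, is identified with its dual, so $V\subset H\simeq H^*\subset V^*$ and the duality $\langle\cdot,\cdot\rangle_V$ on $V^*\times V$ coincides with $m$ on $H\times V$. $a,b:V\times V\to\mathbb{R}$ are continuous bilinear forms; $a$ is symmetric and coercive, with norm $\|v\|^2=a(v,v)$ on $V$; $b+\rho m$ is monotone for some $\rho\ge0$. $A,B\in\mathcal L(V,V^* )$ are given by $\langle Aw,v\rangle_V=a(w,v)$, $\langle Bw,v\rangle_V=b(w,v)$. $\|g\|_\star=\sup_{0\ne v\in V}\langle g,v\rangle_V/\|v\|$ for $g\in V^*$. The solution $u:[0,T]\to V$ satisfies $\langle\ddot u(t),v\rangle_V+b(\dot u(t),v)+a(u(t),v)=\langle f(t),v\rangle_V$ for all $v\in V$, $u(0)=u_0$, $\dot u(0)=u_1$, and $u,\dot u,\ddot u$ take values in $V$ and are regular enough (and $u_0,u_1,f$ interpolable) for the quantities in the statement to make sense. **Semi-discrete problem.** $V_h$ (not necessarily a subspace of $V$) is a family of finite-dimensional spaces with bilinear forms $m_h,a_h,b_h$, where $|v_h|_h^2=m_h(v_h,v_h)$ and $\|v_h\|_h^2=a_h(v_h,v_h)$ are norms ($m_h,a_h$ symmetric) with $|v_h|_h\le C\|v_h\|_h$ and $b_h+\widehat\rho\,m_h$ is monotone for some $\widehat\rho\ge0$. A linear lift $v_h\mapsto v_h^\ell$, $V_h\to V$, satisfies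 $\|v_h^\ell\|\sim\|v_h\|_h$ and $|v_h^\ell|\sim|v_h|_h$ uniformly in $h$; constants are independent of $h$. $v^{-\ell}$ is the inverse lift, i.e. the object whose lift is $v$; $b_h(w,v_h)$ is also evaluated for inverse-lifted $w=v^{-\ell}$. $\widetilde I_h$ is the nodal interpolation into $V_h$, $I_hv=(\widetilde I_hv)^\ell$. The Ritz map $\widetilde R_h:V\to V_h$ is defined by $a_h(\widetilde R_hu,v_h)=a(u,v_h^\ell)$ for all $v_h\in V_h$; $R_hu=(\widetilde R_hu)^\ell$. $u_h$ solves $m_h(\ddot u_h,v_h)+b_h(\dot u_h,v_h)+a_h(u_h,v_h)=m_h(\widetilde I_hf,v_h)$ for all $v_h\in V_h$, $u_h(0)=\widetilde I_hu_0$, $\dot u_h(0)=\widetilde I_hu_1$. **Dual norms and differences.** $\|d_h\|_{\star,h}=\sup_{0\ne v_h\in V_h}m_h(d_h,v_h)/\|v_h\|_h$; $\Delta b(w_h,v_h)=b(w_h^\ell,v_h^\ell)-b_h(w_h,v_h)$; $\|\Delta b(w_h,\cdot)\|_{\star,h}=\sup_{0\ne v_h\in V_h}\Delta b(w_h,v_h)/\|v_h\|_h$. *)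

theory Defs
  imports "HOL-Analysis.Analysis"
begin

section \<open>Bilinear forms, induced norms and dual norms\<close>

definition lin_on :: "'a::real_vector set \<Rightarrow> ('a \<Rightarrow> 'b::real_vector) \<Rightarrow> bool" where
  "lin_on S f \<longleftrightarrow>
     (\<forall>x\<in>S. \<forall>y\<in>S. f (x + y) = f x + f y) \<and> (\<forall>r. \<forall>x\<in>S. f (r *\<^sub>R x) = r *\<^sub>R f x)"

definition bilin_on ::
  "'a::real_vector set \<Rightarrow> 'a set \<Rightarrow> ('a \<Rightarrow> 'a \<Rightarrow> real) \<Rightarrow> bool" where
  "bilin_on S S' f \<longleftrightarrow> (\<forall>y\<in>S'. lin_on S (\<lambda>x. f x y)) \<and> (\<forall>x\<in>S. lin_on S' (f x))"

definition inner_on :: "'a::real_vector set \<Rightarrow> ('a \<Rightarrow> 'a \<Rightarrow> real) \<Rightarrow> bool" where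
  "inner_on S f \<longleftrightarrow>
     bilin_on S S f \<and> (\<forall>x\<in>S. \<forall>y\<in>S. f x y = f y x) \<and> (\<forall>x\<in>S. x \<noteq> 0 \<longrightarrow> 0 < f x x)"

definition monotone_form_on :: "'a set \<Rightarrow> ('a \<Rightarrow> 'a \<Rightarrow> real) \<Rightarrow> bool" where
  "monotone_form_on S f \<longleftrightarrow> (\<forall>x\<in>S. 0 \<le> f x x)"

definition form_norm :: "('a \<Rightarrow> 'a \<Rightarrow> real) \<Rightarrow> 'a \<Rightarrow> real" where
  "form_norm f v = sqrt (f v v)"

text \<open>
  Supremum of \<open>g v / N v\<close> over the nonzero \<open>v \<in> S\<close>. For linear \<open>g\<close> the quotients come in pairs of
  opposite sign, so inserting \<open>0\<close> has no effect unless \<open>S = {0}\<close>, where the value becomes \<open>0\<close>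
  instead of the unspecified \<open>Sup {}\<close>.
\<close>
definition sup_quotient :: "'a::zero set \<Rightarrow> ('a \<Rightarrow> real) \<Rightarrow> ('a \<Rightarrow> real) \<Rightarrow> real" where
  "sup_quotient S N g = Sup (insert 0 {g v / N v | v. v \<in> S \<and> v \<noteq> 0})"

definition form_op ::
  "('v \<Rightarrow> 'v \<Rightarrow> real) \<Rightarrow> 'v::real_normed_vector \<Rightarrow>\<^sub>L ('v \<Rightarrow>\<^sub>L real)" where
  "form_op b = Blinfun (\<lambda>w. Blinfun (b w))"

lemma form_op_apply:
  assumes "bounded_bilinear b"
  shows "blinfun_apply (blinfun_apply (form_op b) w) v = b w v"
proof -
  interpret bounded_bilinear b by fact
  have 1: "blinfun_apply (Blinfun (b w)) = b w" for w
    by (rule bounded_linear_Blinfun_apply) (rule bounded_linear_right)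
  obtain K where K: "K \<ge> 0" "\<And>x y. norm (b x y) \<le> norm x * norm y * K"
    using nonneg_bounded by blast
  have "bounded_linear (\<lambda>w. Blinfun (b w))"
  proof (rule bounded_linear_intro)
    fix x
    have "norm (b x y) \<le> norm x * K * norm y" for y
      using K(2)[of x y] by (simp add: algebra_simps)
    then show "norm (Blinfun (b x)) \<le> norm x * K"
      using K(1) by (intro norm_blinfun_bound) (auto simp: 1)
  qed (auto intro!: blinfun_eqI simp: 1 blinfun.bilinear_simps add_left scaleR_left)
  then show ?thesis
    by (simp add: form_op_def bounded_linear_Blinfun_apply 1)
qed

definition dual_norm ::
  "('v \<Rightarrow> 'v \<Rightarrow> real) \<Rightarrow> ('v::real_normed_vector \<Rightarrow>\<^sub>L real) \<Rightarrow> real" where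
  "dual_norm a g = sup_quotient UNIV (form_norm a) (blinfun_apply g)"

section \<open>The continuous problem\<close>

text \<open>
  The embedding of \<open>V\<close> into \<open>H\<close> is an explicit map \<open>j\<close>; \<open>m\<close> and \<open>|\<cdot>|\<close> are the inner product and
  norm of the type of \<open>H\<close>. Composing \<open>j\<close> with \<open>H \<simeq> H\<^sup>* \<subset> V\<^sup>*\<close> embeds \<open>V\<close> into its dual.
\<close>
definition to_dual ::
  "('v::real_inner \<Rightarrow>\<^sub>L 'h::real_inner) \<Rightarrow> 'v \<Rightarrow> ('v \<Rightarrow>\<^sub>L real)" where
  "to_dual j w = blinfun_inner_right (blinfun_apply j w) o\<^sub>L j"

locale wave_setting =
  fixes j :: "'v::{real_inner, banach} \<Rightarrow>\<^sub>L 'h::{real_inner, banach}"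
    and a b :: "'v \<Rightarrow> 'v \<Rightarrow> real"
  assumes embedding_inj: "inj (blinfun_apply j)"
    and embedding_dense: "closure (range (blinfun_apply j)) = UNIV"
    and a_continuous: "bounded_bilinear a"
    and b_continuous: "bounded_bilinear b"
    and a_symmetric: "a v w = a w v"
    and a_coercive: "\<exists>\<alpha>>0. \<forall>v. \<alpha> * (norm v)\<^sup>2 \<le> a v v"
    and b_quasi_monotone:
      "\<exists>\<rho>\<ge>0. monotone_form_on UNIV (\<lambda>v w. b v w + \<rho> * (blinfun_apply j v \<bullet> blinfun_apply j w))"

definition wave_solution ::
  "('v::{real_inner, banach} \<Rightarrow>\<^sub>L 'h::{real_inner, banach}) \<Rightarrow>
   ('v \<Rightarrow> 'v \<Rightarrow> real) \<Rightarrow> ('v \<Rightarrow> 'v \<Rightarrow> real) \<Rightarrow>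
   real \<Rightarrow> (real \<Rightarrow> 'v \<Rightarrow>\<^sub>L real) \<Rightarrow> 'v \<Rightarrow> 'v \<Rightarrow>
   (real \<Rightarrow> 'v) \<Rightarrow> (real \<Rightarrow> 'v) \<Rightarrow> (real \<Rightarrow> 'v) \<Rightarrow> bool" where
  "wave_solution j a b T f u0 u1 u u' u'' \<longleftrightarrow>
     u 0 = u0 \<and> u' 0 = u1 \<and>
     (\<forall>t\<in>{0..T}.
        (u has_vector_derivative u' t) (at t within {0..T}) \<and>
        (u' has_vector_derivative u'' t) (at t within {0..T}) \<and>
        (\<forall>v. blinfun_apply (to_dual j (u'' t)) v + b (u' t) v + a (u t) v
              = blinfun_apply (f t) v))"

section \<open>The semi-discrete problem\<close>

text \<open>
  Nodal interpolation: \<open>Z \<subseteq> V\<^sup>*\<close> is the space of interpolable elements (elements of \<open>V\<close> and \<open>H\<close> being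
  identified with functionals), \<open>\<sigma> \<phi>\<close> is the evaluation at the node belonging to the basis function
  \<open>\<phi>\<close>, and \<open>\<iota>\<close> sends an element of \<open>V\<^sub>h\<close> to its lift, regarded as an element of \<open>V\<^sup>*\<close>.
\<close>
definition nodal_interpolation ::
  "'x::real_vector set \<Rightarrow> ('x \<Rightarrow> 'z::real_vector) \<Rightarrow> 'z set \<Rightarrow> ('z \<Rightarrow> 'x) \<Rightarrow> bool" where
  "nodal_interpolation Vh \<iota> Z I \<longleftrightarrow>
     (\<exists>\<Phi> \<sigma>. finite \<Phi> \<and> independent \<Phi> \<and> span \<Phi> = Vh \<and>
        (\<forall>\<phi>\<in>\<Phi>. lin_on Z (\<sigma> \<phi> :: 'z \<Rightarrow> real)) \<and>
        (\<forall>\<phi>\<in>\<Phi>. \<iota> \<phi> \<in> Z) \<and>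
        (\<forall>\<phi>\<in>\<Phi>. \<forall>\<psi>\<in>\<Phi>. \<sigma> \<phi> (\<iota> \<psi>) = (if \<phi> = \<psi> then 1 else 0)) \<and>
        (\<forall>g\<in>Z. I g = (\<Sum>\<phi>\<in>\<Phi>. \<sigma> \<phi> g *\<^sub>R \<phi>)))"

text \<open>
  The index \<open>h\<close> ranges over an arbitrary type. All spaces \<open>V\<^sub>h\<close> are finite-dimensional subspaces of
  one ambient normed space; its norm is unrelated to the norms \<open>|\<cdot>|\<^sub>h\<close> and \<open>\<parallel>\<cdot>\<parallel>\<^sub>h\<close> and only provides
  the (unique) topology of \<open>V\<^sub>h\<close> used for time derivatives. \<open>W h\<close> consists of the objects that can be
  lifted: it contains \<open>V\<^sub>h\<close> and the inverse lifts of all elements of \<open>V\<close>, and \<open>b\<^sub>h\<close> accepts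
  elements of \<open>W h\<close> as first argument.
\<close>
locale semi_discrete_setting = wave_setting j a b
  for j :: "'v::{real_inner, banach} \<Rightarrow>\<^sub>L 'h::{real_inner, banach}"
    and a b :: "'v \<Rightarrow> 'v \<Rightarrow> real" +
  fixes Vh W :: "'i \<Rightarrow> 'x::real_normed_vector set"
    and mh ah bh :: "'i \<Rightarrow> 'x \<Rightarrow> 'x \<Rightarrow> real"
    and \<rho>h :: real
    and lft :: "'i \<Rightarrow> 'x \<Rightarrow> 'v"
    and Z :: "('v \<Rightarrow>\<^sub>L real) set"
    and Ih :: "'i \<Rightarrow> ('v \<Rightarrow>\<^sub>L real) \<Rightarrow> 'x"
  assumes Vh_subspace: "subspace (Vh h)"
    and Vh_finite_dim: "\<exists>\<Phi>. finite \<Phi> \<and> span \<Phi> = Vh h"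
    and W_subspace: "subspace (W h)"
    and Vh_subset_W: "Vh h \<subseteq> W h"
    and mh_inner: "inner_on (Vh h) (mh h)"
    and ah_inner: "inner_on (Vh h) (ah h)"
    and bh_bilinear: "bilin_on (W h) (Vh h) (bh h)"
    and \<rho>h_nonneg: "0 \<le> \<rho>h"
    and bh_quasi_monotone: "monotone_form_on (Vh h) (\<lambda>v w. bh h v w + \<rho>h * mh h v w)"
    and mh_le_ah:
      "\<exists>C>0. \<forall>h. \<forall>v\<in>Vh h. form_norm (mh h) v \<le> C * form_norm (ah h) v"
    and lift_linear: "lin_on (W h) (lft h)"
    and lift_bij: "bij_betw (lft h) (W h) UNIV"
    and lift_energy_equiv:
      "\<exists>c>0. \<exists>C>0. \<forall>h. \<forall>v\<in>Vh h.
         c * form_norm (ah h) v \<le> form_norm a (lft h v) \<and>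
         form_norm a (lft h v) \<le> C * form_norm (ah h) v"
    and lift_H_equiv:
      "\<exists>c>0. \<exists>C>0. \<forall>h. \<forall>v\<in>Vh h.
         c * form_norm (mh h) v \<le> norm (blinfun_apply j (lft h v)) \<and>
         norm (blinfun_apply j (lft h v)) \<le> C * form_norm (mh h) v"
    and Z_subspace: "subspace Z"
    and interpolation: "nodal_interpolation (Vh h) (\<lambda>v. to_dual j (lft h v)) Z (Ih h)"

definition semi_discrete_solution ::
  "'x::real_normed_vector set \<Rightarrow> ('x \<Rightarrow> 'x \<Rightarrow> real) \<Rightarrow> ('x \<Rightarrow> 'x \<Rightarrow> real) \<Rightarrow> ('x \<Rightarrow> 'x \<Rightarrow> real) \<Rightarrow>
   real \<Rightarrow> (real \<Rightarrow> 'x) \<Rightarrow> 'x \<Rightarrow> 'x \<Rightarrow>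
   (real \<Rightarrow> 'x) \<Rightarrow> (real \<Rightarrow> 'x) \<Rightarrow> (real \<Rightarrow> 'x) \<Rightarrow> bool" where
  "semi_discrete_solution V m a b T f u0 u1 u u' u'' \<longleftrightarrow>
     u 0 = u0 \<and> u' 0 = u1 \<and>
     (\<forall>t\<in>{0..T}.
        u t \<in> V \<and> u' t \<in> V \<and> u'' t \<in> V \<and>
        (u has_vector_derivative u' t) (at t within {0..T}) \<and>
        (u' has_vector_derivative u'' t) (at t within {0..T}) \<and>
        (\<forall>v\<in>V. m (u'' t) v + b (u' t) v + a (u t) v = m (f t) v))"

definition ritz ::
  "('v \<Rightarrow> 'v \<Rightarrow> real) \<Rightarrow> 'x set \<Rightarrow> ('x \<Rightarrow> 'x \<Rightarrow> real) \<Rightarrow> ('x \<Rightarrow> 'v) \<Rightarrow> 'v \<Rightarrow> 'x" where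
  "ritz a V ah l u = (THE w. w \<in> V \<and> (\<forall>v\<in>V. ah w v = a u (l v)))"

definition delta_form ::
  "('v \<Rightarrow> 'v \<Rightarrow> real) \<Rightarrow> ('x \<Rightarrow> 'x \<Rightarrow> real) \<Rightarrow> ('x \<Rightarrow> 'v) \<Rightarrow> 'x \<Rightarrow> 'x \<Rightarrow> real" where
  "delta_form b bh l w v = b (l w) (l v) - bh w v"

text \<open>\<open>r0, r1, i0, i1\<close> are the Ritz projections and interpolants of \<open>u0, u1\<close> in \<open>V\<^sub>h\<close>.\<close>
definition initial_error ::
  "('v::{real_inner, banach} \<Rightarrow>\<^sub>L 'h::{real_inner, banach}) \<Rightarrow>
   ('v \<Rightarrow> 'v \<Rightarrow> real) \<Rightarrow> ('v \<Rightarrow> 'v \<Rightarrow> real) \<Rightarrow>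
   'x::real_normed_vector set \<Rightarrow> 'x set \<Rightarrow> ('x \<Rightarrow> 'x \<Rightarrow> real) \<Rightarrow> ('x \<Rightarrow> 'x \<Rightarrow> real) \<Rightarrow>
   ('x \<Rightarrow> 'v) \<Rightarrow> (('v \<Rightarrow>\<^sub>L real) \<Rightarrow> 'x) \<Rightarrow> real \<Rightarrow> 'v \<Rightarrow> 'v \<Rightarrow> real" where
  "initial_error j a b V W ah bh l I c u0 u1 =
     (let i0 = I (to_dual j u0); i1 = I (to_dual j u1);
          r0 = ritz a V ah l u0; r1 = ritz a V ah l u1;
          u0_inv = inv_into W l u0;
          \<Delta>norm = (\<lambda>w. sup_quotient V (form_norm ah) (delta_form b bh l w))
      in norm (blinfun_apply j (l i1 - u1)) + norm (blinfun_apply j (l i0 - u0))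
       + norm (blinfun_apply j (l r1 - u1)) + norm (blinfun_apply j (l r0 - u0))
       + \<Delta>norm (r0 - u0_inv) + \<Delta>norm (i0 - u0_inv)
       + c * dual_norm a (blinfun_apply (form_op b) (l r0 - u0))
       + c * dual_norm a (blinfun_apply (form_op b) (l i0 - u0)))"

definition is_defect ::
  "('v \<Rightarrow> 'v \<Rightarrow> real) \<Rightarrow> 'x::real_vector set \<Rightarrow>
   ('x \<Rightarrow> 'x \<Rightarrow> real) \<Rightarrow> ('x \<Rightarrow> 'x \<Rightarrow> real) \<Rightarrow> ('x \<Rightarrow> 'x \<Rightarrow> real) \<Rightarrow> ('x \<Rightarrow> 'v) \<Rightarrow>
   real \<Rightarrow> (real \<Rightarrow> 'x) \<Rightarrow> (real \<Rightarrow> 'v) \<Rightarrow> (real \<Rightarrow> 'v) \<Rightarrow> (real \<Rightarrow> 'v) \<Rightarrow>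
   (real \<Rightarrow> 'x) \<Rightarrow> bool" where
  "is_defect a V mh ah bh l T fh u u' u'' d \<longleftrightarrow>
     (\<forall>t\<in>{0..T}. d t \<in> V \<and>
        (\<forall>v\<in>V. mh (ritz a V ah l (u'' t)) v + bh (ritz a V ah l (u' t)) v
                  + ah (ritz a V ah l (u t)) v
                = mh (fh t) v + mh (d t) v))"

definition defect_norm ::
  "'x::real_vector set \<Rightarrow> ('x \<Rightarrow> 'x \<Rightarrow> real) \<Rightarrow> ('x \<Rightarrow> 'x \<Rightarrow> real) \<Rightarrow> 'x \<Rightarrow> real" where
  "defect_norm V mh ah d = sup_quotient V (form_norm ah) (mh d)"

end

theory Submission
  imports Defs
begin

text \<open>
  The error \<open>e = u\<^sub>h - R\<^sub>h u\<close> solves the semi-discrete equation with right-hand side \<open>-d\<^sub>h\<close>, but an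
  estimate of \<open>|e|\<^sub>h\<close> rather than \<open>|e'|\<^sub>h\<close> and \<open>\<parallel>e\<parallel>\<^sub>h\<close> is wanted. So the equation is integrated in time:
  with \<open>E\<close> the primitive of \<open>e\<close> that vanishes at \<open>0\<close>, the functional
  \<open>g(s) = m\<^sub>h(e', \<cdot>) + b\<^sub>h(e, \<cdot>) + a\<^sub>h(E, \<cdot>)\<close> has derivative \<open>-m\<^sub>h(d\<^sub>h, \<cdot>)\<close>, hence its dual norm is at most
  that of \<open>g(0)\<close> (controlled by the initial errors) plus \<open>\<integral>\<parallel>d\<^sub>h\<parallel>\<close>. Testing with \<open>e = E'\<close> bounds
  \<open>e\<^sup>-\<^sup>2\<^sup>\<rho>\<^sup>s (|e|\<^sup>2 + \<parallel>E\<parallel>\<^sup>2)\<close>; the term \<open>g(e)\<close> is moved onto \<open>E\<close> by an integration by parts, because \<open>\<parallel>e\<parallel>\<^sub>h\<close>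
  is not controlled. The weight \<open>e\<^sup>-\<^sup>2\<^sup>\<rho>\<^sup>s\<close> together with \<open>\<parallel>E(s)\<parallel> \<le> M e\<^sup>\<rho>\<^sup>s\<close>, where \<open>M\<^sup>2\<close> is the maximum of the
  weighted energy, makes all constants independent of \<open>\<rho>\<close> and \<open>T\<close>.
\<close>

section \<open>Inner products and bilinear forms on finite-dimensional subspaces\<close>

lemma lin_on_add: "lin_on S f \<Longrightarrow> x \<in> S \<Longrightarrow> y \<in> S \<Longrightarrow> f (x + y) = f x + f y"
  by (simp add: lin_on_def)

lemma lin_on_scaleR: "lin_on S f \<Longrightarrow> x \<in> S \<Longrightarrow> f (r *\<^sub>R x) = r *\<^sub>R f x"
  by (simp add: lin_on_def)

lemma lin_on_subset: "lin_on S f \<Longrightarrow> S' \<subseteq> S \<Longrightarrow> lin_on S' f"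
  unfolding lin_on_def by blast

lemma lin_on_zero: "lin_on S f \<Longrightarrow> 0 \<in> S \<Longrightarrow> f 0 = 0"
  using lin_on_scaleR[of S f 0 0] by simp

lemma lin_on_diff:
  assumes "lin_on S f" "subspace S" "x \<in> S" "y \<in> S"
  shows "f (x - y) = f x - f y"
  using lin_on_add[OF assms(1), of x "- y"] lin_on_scaleR[OF assms(1), of y "-1"] assms
  by (simp add: subspace_neg)

lemma lin_on_sum:
  assumes "lin_on S f" "subspace S" "\<And>i. i \<in> I \<Longrightarrow> x i \<in> S"
  shows "f (\<Sum>i\<in>I. c i *\<^sub>R x i) = (\<Sum>i\<in>I. c i *\<^sub>R f (x i))"
  using assms(3)
proof (induction I rule: infinite_finite_induct)
  case (insert i I)
  then have "(\<Sum>i\<in>I. c i *\<^sub>R x i) \<in> S"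
    by (intro subspace_sum[OF assms(2)] subspace_scale[OF assms(2)]) auto
  with insert show ?case
    using assms(1,2) by (simp add: lin_on_add lin_on_scaleR subspace_scale)
qed (simp_all add: lin_on_zero[OF assms(1)] subspace_0[OF assms(2)])

lemma bilin_on_left: "bilin_on S S' f \<Longrightarrow> y \<in> S' \<Longrightarrow> lin_on S (\<lambda>x. f x y)"
  by (simp add: bilin_on_def)

lemma bilin_on_right: "bilin_on S S' f \<Longrightarrow> x \<in> S \<Longrightarrow> lin_on S' (f x)"
  by (simp add: bilin_on_def)

lemma bilin_on_subset: "bilin_on S S' f \<Longrightarrow> U \<subseteq> S \<Longrightarrow> U' \<subseteq> S' \<Longrightarrow> bilin_on U U' f"
  by (simp add: bilin_on_def lin_on_def subset_iff)

lemma inner_on_subset: "inner_on S f \<Longrightarrow> U \<subseteq> S \<Longrightarrow> inner_on U f"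
  using bilin_on_subset[of S S f U U] by (simp add: inner_on_def subset_iff)

lemma inner_on_bilin: "inner_on S f \<Longrightarrow> bilin_on S S f"
  by (simp add: inner_on_def)

lemma inner_on_sym: "inner_on S f \<Longrightarrow> x \<in> S \<Longrightarrow> y \<in> S \<Longrightarrow> f x y = f y x"
  by (simp add: inner_on_def)

lemma inner_on_nonneg:
  assumes "inner_on S f" "x \<in> S"
  shows "0 \<le> f x x"
proof (cases "x = 0")
  case True
  then show ?thesis
    using assms lin_on_zero[OF bilin_on_right[OF inner_on_bilin[OF assms(1)] assms(2)]] by auto
qed (use assms in \<open>auto simp: inner_on_def less_imp_le\<close>)

lemma form_norm_nonneg [simp]: "inner_on S f \<Longrightarrow> x \<in> S \<Longrightarrow> 0 \<le> form_norm f x"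
  by (simp add: form_norm_def inner_on_nonneg)

lemma form_norm_pos: "inner_on S f \<Longrightarrow> x \<in> S \<Longrightarrow> x \<noteq> 0 \<Longrightarrow> 0 < form_norm f x"
  by (simp add: form_norm_def inner_on_def)

lemma form_norm_sq: "inner_on S f \<Longrightarrow> x \<in> S \<Longrightarrow> (form_norm f x)\<^sup>2 = f x x"
  by (simp add: form_norm_def inner_on_nonneg)

lemma inner_on_Cauchy_Schwarz:
  assumes f: "inner_on S f" and S: "subspace S" and xy: "x \<in> S" "y \<in> S"
  shows "\<bar>f x y\<bar> \<le> form_norm f x * form_norm f y"
proof (cases "y = 0")
  case True
  then show ?thesis
    using lin_on_zero[OF bilin_on_right[OF inner_on_bilin[OF f] xy(1)]] xy f by auto
next
  case False
  then have pos: "f y y > 0" using f xy by (auto simp: inner_on_def)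
  note L = bilin_on_left[OF inner_on_bilin[OF f]] and R = bilin_on_right[OF inner_on_bilin[OF f]]
  \<comment> \<open>\<open>k *\<^sub>R y\<close> is the orthogonal projection of \<open>x\<close>
    onto the line through \<open>y\<close>; this \<open>k\<close> minimises the square expanded
    below.\<close>
  define k where "k = f x y / f y y"
  have ky: "k *\<^sub>R y \<in> S" "x - k *\<^sub>R y \<in> S"
    using S xy by (auto intro: subspace_scale subspace_diff)
  have "0 \<le> f (x - k *\<^sub>R y) (x - k *\<^sub>R y)"
    using inner_on_nonneg[OF f ky(2)] .
  also have "\<dots> = f x x - k * f x y - k * (f y x - k * f y y)"
    using lin_on_diff[OF L S xy(1) ky(1)] lin_on_scaleR[OF L xy(2)]
      lin_on_diff[OF R S xy(1) ky(1)] lin_on_scaleR[OF R xy(2)] xy ky(2)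
    by (simp add: right_diff_distrib)
  also have "\<dots> = f x x - (f x y)\<^sup>2 / f y y"
    using pos inner_on_sym[OF f xy] by (simp add: k_def field_simps power2_eq_square)
  finally have "(f x y)\<^sup>2 \<le> f x x * f y y"
    using pos by (simp add: field_simps)
  then show ?thesis
    by (metis form_norm_def real_sqrt_abs real_sqrt_le_iff real_sqrt_mult)
qed

section \<open>Orthonormal bases of finite-dimensional subspaces\<close>

definition orthonormal_basis :: "('a::real_vector \<Rightarrow> 'a \<Rightarrow> real) \<Rightarrow> 'a set \<Rightarrow> 'a set \<Rightarrow> bool" where
  "orthonormal_basis a V B \<longleftrightarrow>
     finite B \<and> span B = V \<and> (\<forall>x\<in>B. \<forall>y\<in>B. a x y = (if x = y then 1 else 0))"

lemma orthonormal_basisD: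
  assumes "orthonormal_basis a V B"
  shows "finite B" "span B = V" "subspace V" "\<And>b. b \<in> B \<Longrightarrow> b \<in> V"
    and "\<And>x y. x \<in> B \<Longrightarrow> y \<in> B \<Longrightarrow> a x y = (if x = y then 1 else 0)"
  using assms span_base by (auto simp: orthonormal_basis_def)

text \<open>Gram-Schmidt, one vector per induction step: the projection \<open>p\<close> of the new
  vector onto the previous span is subtracted and the remainder normalised. A vector already in the
  span adds nothing.\<close>

lemma inner_on_orthonormal_basis:
  assumes "finite \<Phi>" "inner_on (span \<Phi>) a"
  shows "\<exists>B. orthonormal_basis a (span \<Phi>) B"
  unfolding orthonormal_basis_def
  using assms
proof (induction \<Phi>)
  case empty
  then show ?case by (intro exI[of _ "{}"]) auto
next
  case (insert x F)
  have "inner_on (span F) a"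
    by (rule inner_on_subset[OF insert.prems]) (simp add: span_mono subset_insertI)
  then obtain B where B: "finite B" "span B = span F"
    and orthB: "\<And>b c. b \<in> B \<Longrightarrow> c \<in> B \<Longrightarrow> a b c = (if b = c then 1 else 0)"
    using insert.IH by blast
  show ?case
  proof (cases "x \<in> span F")
    case True
    then show ?thesis using B orthB by (intro exI[of _ B]) (simp add: span_redundant)
  next
    case False
    let ?V = "span (insert x F)"
    have sub: "subspace ?V" by simp
    have FV: "span F \<subseteq> ?V" by (simp add: span_mono subset_insertI)
    then have BV: "b \<in> ?V" if "b \<in> B" for b using that B(2) span_base by blast
    note L = bilin_on_left[OF inner_on_bilin[OF insert.prems]]
      and R = bilin_on_right[OF inner_on_bilin[OF insert.prems]]
    define p where "p = (\<Sum>b\<in>B. a x b *\<^sub>R b)"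
    define y where "y = x - p"
    have p: "p \<in> span F" unfolding p_def B(2)[symmetric]
      by (intro span_sum span_scale span_base)
    have xV: "x \<in> ?V" by (simp add: span_base)
    have yV: "y \<in> ?V" using p FV xV by (auto simp: y_def intro: span_diff)
    have "y \<noteq> 0" using False p by (auto simp: y_def)
    then have pos: "a y y > 0" using insert.prems yV by (simp add: inner_on_def)
    have orth: "a y c = 0" if "c \<in> B" for c
    proof -
      have "a p c = (\<Sum>b\<in>B. a x b *\<^sub>R a b c)"
        unfolding p_def by (rule lin_on_sum[OF L[OF BV[OF that]] sub BV])
      also have "\<dots> = (\<Sum>b\<in>B. if b = c then a x b else 0)"
        using orthB that by (intro sum.cong) auto
      also have "\<dots> = a x c" using B(1) that by simp
      finally show ?thesis
        using lin_on_diff[OF L[OF BV[OF that]] sub xV, of p] p FV by (auto simp: y_def)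
    qed
    define z where "z = (1 / sqrt (a y y)) *\<^sub>R y"
    have zV: "z \<in> ?V" unfolding z_def using yV by (rule span_scale)
    have zc: "a z c = 0" if "c \<in> B" for c
      using orth[OF that] lin_on_scaleR[OF L[OF BV[OF that]] yV] by (simp add: z_def)
    have zz: "a z z = 1"
      using pos lin_on_scaleR[OF L[OF zV] yV] lin_on_scaleR[OF R[OF yV] yV]
      by (simp add: z_def)
    have "x = sqrt (a y y) *\<^sub>R z + p" using pos by (simp add: z_def y_def)
    also have "\<dots> \<in> span (insert z B)"
      using p B(2) span_mono[OF subset_insertI[of B z]]
      by (intro span_add span_scale) (auto simp: span_base)
    finally have 1: "x \<in> span (insert z B)" .
    have "F \<subseteq> span (insert z B)"
      using B(2) span_superset[of F] span_mono[OF subset_insertI[of B z]] by blast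
    then have "span (insert z B) = ?V"
      using 1 zV BV by (subst span_eq) auto
    moreover have "z \<notin> B" using zc zz by force
    moreover have "a c z = 0" if "c \<in> B" for c
      using inner_on_sym[OF insert.prems BV[OF that] zV] zc[OF that] by simp
    ultimately show ?thesis
      using B(1) orthB zz zc \<open>z \<notin> B\<close> by (intro exI[of _ "insert z B"]) auto
  qed
qed

lemma orthonormal_expansion:
  assumes a: "inner_on V a" and B: "orthonormal_basis a V B"
    and x: "x \<in> V"
  shows "x = (\<Sum>b\<in>B. a x b *\<^sub>R b)"
proof -
  note fin = orthonormal_basisD(1)[OF B] and spn = orthonormal_basisD(2)[OF B]
    and sub = orthonormal_basisD(3)[OF B] and BV = orthonormal_basisD(4)[OF B]
    and orth = orthonormal_basisD(5)[OF B]
  obtain c where c: "x = (\<Sum>b\<in>B. c b *\<^sub>R b)"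
    using x spn span_finite[OF fin] by auto
  have "a x b = c b" if b: "b \<in> B" for b
  proof -
    have "a x b = (\<Sum>b'\<in>B. c b' *\<^sub>R a b' b)"
      unfolding c by (rule lin_on_sum[OF bilin_on_left[OF inner_on_bilin[OF a] BV[OF b]] sub BV])
    also have "\<dots> = (\<Sum>b'\<in>B. if b' = b then c b' else 0)"
      using orth b by (intro sum.cong) auto
    also have "\<dots> = c b" using fin b by simp
    finally show ?thesis .
  qed
  then show ?thesis using c by simp
qed

text \<open>Riesz representation with an explicit representer. Symmetry turns the coefficients
  \<open>a b v\<close> into the coordinates of \<open>v\<close>, and linearity of \<open>F\<close>
  reassembles \<open>v\<close>. The explicit sum later gives the Ritz map in coordinates.\<close>

lemma inner_on_representation:
  assumes a: "inner_on V a" and B: "orthonormal_basis a V B"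
    and F: "lin_on V F" and v: "v \<in> V"
  shows "a (\<Sum>b\<in>B. F b *\<^sub>R b) v = F v"
proof -
  note sub = orthonormal_basisD(3)[OF B] and BV = orthonormal_basisD(4)[OF B]
  have "a (\<Sum>b\<in>B. F b *\<^sub>R b) v = (\<Sum>b\<in>B. F b *\<^sub>R a b v)"
    by (rule lin_on_sum[OF bilin_on_left[OF inner_on_bilin[OF a] v] sub BV])
  also have "\<dots> = (\<Sum>b\<in>B. a v b *\<^sub>R F b)"
    using inner_on_sym[OF a _ v] BV by (intro sum.cong) auto
  also have "\<dots> = F (\<Sum>b\<in>B. a v b *\<^sub>R b)"
    by (rule lin_on_sum[OF F sub BV, symmetric])
  also have "\<dots> = F v" using orthonormal_expansion[OF a B v] by simp
  finally show ?thesis .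
qed

section \<open>Completeness, bounded functionals and time derivatives in finite dimensions\<close>

lemma Cauchy_diff:
  fixes X Y :: "nat \<Rightarrow> 'a::real_normed_vector"
  assumes "Cauchy X" "Cauchy Y"
  shows "Cauchy (\<lambda>n. X n - Y n)"
proof (rule CauchyI)
  fix e :: real assume "e > 0"
  then obtain M N where M: "\<And>m n. m \<ge> M \<Longrightarrow> n \<ge> M \<Longrightarrow> norm (X m - X n) < e / 2"
    and N: "\<And>m n. m \<ge> N \<Longrightarrow> n \<ge> N \<Longrightarrow> norm (Y m - Y n) < e / 2"
    using assms by (meson Cauchy_iff half_gt_zero)
  have "norm ((X m - Y m) - (X n - Y n)) < e" if "m \<ge> max M N" "n \<ge> max M N" for m n
    using M[of m n] N[of m n] that norm_triangle_ineq4[of "X m - X n" "Y m - Y n"]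
    by (simp add: algebra_simps)
  then show "\<exists>M. \<forall>m\<ge>M. \<forall>n\<ge>M. norm ((X m - Y m) - (X n - Y n)) < e" by blast
qed

text \<open>A complete span is closed, so a new vector \<open>x\<close> outside it has a positive
  distance \<open>\<delta>\<close> from it. This bounds the coefficient of \<open>x\<close> by the
  norm divided by \<open>\<delta>\<close>, from which both claims follow. They share one induction
  because the bound on functionals uses completeness of the smaller span.\<close>

lemma span_finite_complete_bounded:
  fixes B :: "'a::real_normed_vector set"
  assumes "finite B"
  shows "complete (span B) \<and>
    (\<forall>F :: 'a \<Rightarrow> real. lin_on (span B) F \<longrightarrow> (\<exists>K. \<forall>x\<in>span B. \<bar>F x\<bar> \<le> K * norm x))"
  using assms
proof (induction B)
  case empty
  have "lin_on {0} F \<Longrightarrow> F 0 = (0::real)" for F :: "'a \<Rightarrow> real"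
    by (rule lin_on_zero) auto
  then show ?case by (auto simp: compact_imp_complete)
next
  case (insert x B)
  show ?case
  proof (cases "x \<in> span B")
    case True
    then show ?thesis using insert.IH by (simp add: span_redundant)
  next
    case False
    have cpl: "complete (span B)" using insert.IH by blast
    then have "open (- span B)" by (simp add: complete_imp_closed open_Compl)
    then obtain \<delta> where \<delta>: "\<delta> > 0" "ball x \<delta> \<subseteq> - span B"
      using False by (meson ComplI open_contains_ball)
    then have dist: "\<delta> \<le> dist x y" if "y \<in> span B" for y
      using that by (force simp: not_less[symmetric])
    \<comment> \<open>Homogeneity: after division by \<open>k\<close> the norm is the distance from
      \<open>x\<close> to a point of \<open>span B\<close>.\<close>
    have coef: "\<bar>k\<bar> * \<delta> \<le> norm (y + k *\<^sub>R x)" if y: "y \<in> span B" for y k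
    proof (cases "k = 0")
      case False
      have "\<delta> \<le> norm (x - (- 1 / k) *\<^sub>R y)"
        using dist[OF span_scale[OF y]] by (metis dist_norm)
      then have "\<bar>k\<bar> * \<delta> \<le> norm (k *\<^sub>R (x - (- 1 / k) *\<^sub>R y))"
        by (simp add: mult_left_mono)
      also have "k *\<^sub>R (x - (- 1 / k) *\<^sub>R y) = y + k *\<^sub>R x"
        using False by (simp add: algebra_simps)
      finally show ?thesis .
    qed simp
    have ex: "\<exists>y k. z = y + k *\<^sub>R x \<and> y \<in> span B" if "z \<in> span (insert x B)" for z
    proof -
      from that obtain k where "z - k *\<^sub>R x \<in> span B" by (auto simp: span_insert)
      then show ?thesis by (intro exI[of _ "z - k *\<^sub>R x"] exI[of _ k]) simp
    qed
    have yV: "y \<in> span (insert x B)" if "y \<in> span B" for y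
      using that span_mono[OF subset_insertI] by blast
    have xV: "x \<in> span (insert x B)" by (simp add: span_base)
    have "complete (span (insert x B))"
      unfolding complete_def
    proof (intro allI impI, elim conjE)
      fix z :: "nat \<Rightarrow> 'a" assume z: "\<forall>n. z n \<in> span (insert x B)" "Cauchy z"
      then obtain y k where yk: "\<And>n. z n = y n + k n *\<^sub>R x" "\<And>n. y n \<in> span B"
      proof -
        have "\<forall>n. \<exists>p. z n = fst p + snd p *\<^sub>R x \<and> fst p \<in> span B" using ex z(1) by simp
        then obtain p where "\<forall>n. z n = fst (p n) + snd (p n) *\<^sub>R x \<and> fst (p n) \<in> span B"
          by (rule choice[THEN exE])
        then show ?thesis using that[of "fst \<circ> p" "snd \<circ> p"] by simp
      qed
      have k: "\<bar>k m - k n\<bar> * \<delta> \<le> dist (z m) (z n)" for m n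
        using coef[of "y m - y n" "k m - k n"] yk
        by (simp add: dist_norm span_diff algebra_simps)
      \<comment> \<open>By \<open>coef\<close> the coefficients inherit the Cauchy property;
        subtracting their contribution leaves a Cauchy sequence in \<open>span B\<close>, which has
        a limit there by induction.\<close>
      have "Cauchy k"
        unfolding Cauchy_def
      proof (intro allI impI)
        fix e :: real assume "e > 0"
        then obtain M where M: "\<And>m n. m \<ge> M \<Longrightarrow> n \<ge> M \<Longrightarrow> dist (z m) (z n) < e * \<delta>"
          using z(2) mult_pos_pos[OF \<open>e > 0\<close> \<delta>(1)] unfolding Cauchy_def by meson
        have "dist (k m) (k n) < e" if "m \<ge> M" "n \<ge> M" for m n
          using le_less_trans[OF k M[OF that]] \<delta>(1) by (simp add: dist_real_def)
        then show "\<exists>M. \<forall>m\<ge>M. \<forall>n\<ge>M. dist (k m) (k n) < e" by blast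
      qed
      then obtain l where l: "k \<longlonglongrightarrow> l" using Cauchy_convergent convergent_def by blast
      have "Cauchy (\<lambda>n. k n *\<^sub>R x)"
        using l by (intro LIMSEQ_imp_Cauchy[of _ "l *\<^sub>R x"] tendsto_intros)
      then have "Cauchy (\<lambda>n. z n - k n *\<^sub>R x)" by (rule Cauchy_diff[OF z(2)])
      then have "Cauchy y" using yk(1) by simp
      then obtain w where w: "w \<in> span B" "y \<longlonglongrightarrow> w"
        using cpl yk(2) unfolding complete_def by blast
      have "z \<longlonglongrightarrow> w + l *\<^sub>R x"
        using tendsto_add[OF w(2) tendsto_scaleR[OF l tendsto_const[of x]]] yk(1) by presburger
      then show "\<exists>l\<in>span (insert x B). z \<longlonglongrightarrow> l"
        using w(1) yV xV by (intro bexI[of _ "w + l *\<^sub>R x"]) (auto intro: span_add span_scale)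
    qed
    moreover have "\<exists>K. \<forall>z\<in>span (insert x B). \<bar>F z\<bar> \<le> K * norm z"
      if F: "lin_on (span (insert x B)) F" for F :: "'a \<Rightarrow> real"
    proof -
      have "lin_on (span B) F" using F yV by (auto simp: lin_on_def)
      then obtain K0 where K0: "\<And>y. y \<in> span B \<Longrightarrow> \<bar>F y\<bar> \<le> K0 * norm y"
        using insert.IH by blast
      define K where "K = \<bar>K0\<bar>"
      have K: "\<bar>F y\<bar> \<le> K * norm y" if "y \<in> span B" for y
        using K0[OF that] mult_right_mono[of K0 K "norm y"] by (fastforce simp: K_def)
      have "\<bar>F z\<bar> \<le> (K + K * norm x / \<delta> + \<bar>F x\<bar> / \<delta>) * norm z"
        if z: "z \<in> span (insert x B)" for z
      proof -
        obtain y k where yk: "z = y + k *\<^sub>R x" "y \<in> span B" using ex[OF z] by blast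
        have kb: "\<bar>k\<bar> \<le> norm z / \<delta>"
          using coef[OF yk(2), of k] yk(1) \<delta>(1) by (simp add: field_simps)
        have "\<bar>F z\<bar> = \<bar>F y + k * F x\<bar>"
          using lin_on_add[OF F yV[OF yk(2)] span_scale[OF xV]] lin_on_scaleR[OF F xV] yk(1)
          by simp
        also have "\<dots> \<le> K * norm y + \<bar>k\<bar> * \<bar>F x\<bar>"
          using K[OF yk(2)] abs_triangle_ineq[of "F y" "k * F x"] by (simp add: abs_mult)
        also have "\<dots> \<le> K * (norm z + norm z / \<delta> * norm x) + norm z / \<delta> * \<bar>F x\<bar>"
        proof (intro add_mono mult_left_mono mult_right_mono kb)
          have "norm y \<le> norm z + \<bar>k\<bar> * norm x"
            using norm_triangle_ineq4[of z "k *\<^sub>R x"] yk(1) by simp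
          also have "\<bar>k\<bar> * norm x \<le> norm z / \<delta> * norm x" by (intro mult_right_mono kb) simp
          finally show "norm y \<le> norm z + norm z / \<delta> * norm x" by simp
        qed (simp_all add: K_def)
        finally show ?thesis by (simp add: algebra_simps)
      qed
      then show ?thesis by blast
    qed
    ultimately show ?thesis by blast
  qed
qed

lemma lin_on_finite_span_bounded:
  fixes F :: "'a::real_normed_vector \<Rightarrow> real"
  assumes "finite B" "lin_on (span B) F"
  shows "\<exists>K. \<forall>x\<in>span B. \<bar>F x\<bar> \<le> K * norm x"
  using span_finite_complete_bounded[OF assms(1)] assms(2) by blast

text \<open>\<open>F\<close> is linear only on \<open>V\<close>, so the chain rule for bounded
  linear maps on the ambient space does not apply. But the Taylor remainder of \<open>f\<close>
  stays in the subspace \<open>V\<close>, where \<open>F\<close> is bounded by finite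
  dimension.\<close>

lemma lin_on_has_real_derivative:
  fixes F :: "'a::real_normed_vector \<Rightarrow> real"
  assumes B: "finite B" "span B = V" and F: "lin_on V F"
    and f: "(f has_vector_derivative f') (at t within S)"
    and V: "\<And>s. s \<in> S \<Longrightarrow> f s \<in> V" "f' \<in> V" and t: "t \<in> S"
  shows "((\<lambda>s. F (f s)) has_real_derivative F f') (at t within S)"
proof -
  have sub: "subspace V" using B(2) by auto
  obtain K0 where K0: "\<And>x. x \<in> V \<Longrightarrow> \<bar>F x\<bar> \<le> K0 * norm x"
    using lin_on_finite_span_bounded[OF B(1), of F] F B(2) by blast
  \<comment> \<open>The sign of \<open>K0\<close> is unknown; the added 1 makes the bound positive,
    so that \<open>e / K\<close> can serve as tolerance.\<close>
  define K where "K = \<bar>K0\<bar> + 1"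
  have K: "\<bar>F x\<bar> \<le> K * norm x" if "x \<in> V" for x
    using K0[OF that] mult_right_mono[of K0 K "norm x"] by (fastforce simp: K_def)
  have Kp: "K > 0" by (simp add: K_def)
  show ?thesis
    unfolding has_field_derivative_def has_derivative_within_alt
  proof (intro conjI allI impI)
    show "bounded_linear ((*) (F f'))" by (rule bounded_linear_mult_right)
    fix e :: real assume "e > 0"
    then have "e / K > 0" using Kp by simp
    moreover have "\<forall>e>0. \<exists>d>0. \<forall>y\<in>S. norm (y - t) < d \<longrightarrow>
        norm (f y - f t - (y - t) *\<^sub>R f') \<le> e * norm (y - t)"
      using f by (simp add: has_vector_derivative_def has_derivative_within_alt)
    ultimately obtain d where d: "d > 0" "\<And>y. y \<in> S \<Longrightarrow> norm (y - t) < d \<Longrightarrow>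
        norm (f y - f t - (y - t) *\<^sub>R f') \<le> e / K * norm (y - t)"
      by meson
    have "norm (F (f y) - F (f t) - F f' * (y - t)) \<le> e * norm (y - t)"
      if y: "y \<in> S" "norm (y - t) < d" for y
    proof -
      let ?r = "f y - f t - (y - t) *\<^sub>R f'"
      have mem: "f y - f t \<in> V" "(y - t) *\<^sub>R f' \<in> V"
        using V t y(1) sub by (auto intro: subspace_diff subspace_scale)
      have "F ?r = F (f y) - F (f t) - F f' * (y - t)"
        using lin_on_diff[OF F sub mem] lin_on_diff[OF F sub V(1) V(1), of y t]
          lin_on_scaleR[OF F V(2)] y(1) t by simp
      then have "norm (F (f y) - F (f t) - F f' * (y - t)) \<le> K * norm ?r"
        using K[OF subspace_diff[OF sub mem]] by simp
      also have "\<dots> \<le> K * (e / K * norm (y - t))"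
        using d(2)[OF y] Kp by (intro mult_left_mono) auto
      finally show ?thesis using Kp by simp
    qed
    then show "\<exists>d>0. \<forall>y\<in>S. norm (y - t) < d \<longrightarrow>
        norm (F (f y) - F (f t) - F f' * (y - t)) \<le> e * norm (y - t)"
      using d(1) by blast
  qed
qed

text \<open>Expanding the first argument in an orthonormal basis makes \<open>m (f s) (g s)\<close>
  a finite sum of products of linear functionals of \<open>f s\<close> and \<open>g s\<close>, so
  the scalar product rule suffices.\<close>

lemma bilin_on_has_real_derivative:
  fixes m :: "'a::real_normed_vector \<Rightarrow> 'a \<Rightarrow> real"
  assumes a: "inner_on V a" and B: "orthonormal_basis a V B"
    and m: "bilin_on V V m"
    and f: "(f has_vector_derivative f') (at t within S)" "\<And>s. s \<in> S \<Longrightarrow> f s \<in> V" "f' \<in> V"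
    and g: "(g has_vector_derivative g') (at t within S)" "\<And>s. s \<in> S \<Longrightarrow> g s \<in> V" "g' \<in> V"
    and t: "t \<in> S"
  shows "((\<lambda>s. m (f s) (g s)) has_real_derivative m f' (g t) + m (f t) g') (at t within S)"
proof -
  note fin = orthonormal_basisD(1)[OF B] and spn = orthonormal_basisD(2)[OF B]
    and sub = orthonormal_basisD(3)[OF B] and BV = orthonormal_basisD(4)[OF B]
  have m_eq: "m x y = (\<Sum>b\<in>B. a x b * m b y)" if "x \<in> V" "y \<in> V" for x y
    using lin_on_sum[OF bilin_on_left[OF m that(2)] sub BV, where I = B and x = "\<lambda>b. b" and c = "a x"]
      orthonormal_expansion[OF a B that(1)] by simp
  have "((\<lambda>s. \<Sum>b\<in>B. a (f s) b * m b (g s)) has_real_derivative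
      (\<Sum>b\<in>B. a f' b * m b (g t) + m b g' * a (f t) b)) (at t within S)"
    by (intro DERIV_sum DERIV_mult
        lin_on_has_real_derivative[OF fin spn bilin_on_left[OF inner_on_bilin[OF a] BV] f t]
        lin_on_has_real_derivative[OF fin spn bilin_on_right[OF m BV] g t])
  then have "((\<lambda>s. \<Sum>b\<in>B. a (f s) b * m b (g s)) has_real_derivative
      m f' (g t) + m (f t) g') (at t within S)"
    using m_eq[OF f(3) g(2)[OF t]] m_eq[OF f(2)[OF t] g(3)]
    by (simp add: sum.distrib mult.commute)
  then show ?thesis
    unfolding has_field_derivative_def
    by (rule has_derivative_transform[OF t, rotated]) (use m_eq f g in auto)
qed

section \<open>The energy estimate\<close>

text \<open>For the gauge integral every derivative is integrable, so no regularity of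
  \<open>F'\<close> is required. This matters because no continuity in time of the defect is
  assumed.\<close>

lemma increment_le_integral:
  fixes F :: "real \<Rightarrow> real"
  assumes "0 \<le> t"
    and "\<And>s. s \<in> {0..t} \<Longrightarrow> (F has_real_derivative F' s) (at s within {0..t})"
    and "\<And>s. s \<in> {0..t} \<Longrightarrow> F' s \<le> n s"
    and "n integrable_on {0..t}"
  shows "F t - F 0 \<le> integral {0..t} n"
proof (rule has_integral_le)
  show "(F' has_integral F t - F 0) {0..t}"
    using assms(1,2) by (intro fundamental_theorem_of_calculus)
      (auto simp: has_real_derivative_iff_has_vector_derivative)
qed (use assms in \<open>auto intro: integrable_integral\<close>)

text \<open>The ambient space may be incomplete, so the integration is done on the real coordinates
  in an orthonormal basis. This also keeps the primitive inside \<open>V\<close>.\<close>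

lemma primitive_on_subspace:
  fixes e :: "real \<Rightarrow> 'x::real_normed_vector"
  assumes a: "inner_on V a" and B: "orthonormal_basis a V B"
    and e: "\<And>s. s \<in> {0..t} \<Longrightarrow> e s \<in> V"
      "\<And>s. s \<in> {0..t} \<Longrightarrow> (e has_vector_derivative e' s) (at s within {0..t})"
      "\<And>s. s \<in> {0..t} \<Longrightarrow> e' s \<in> V"
  obtains E where "\<And>s. E s \<in> V" "E 0 = 0"
    "\<And>s. s \<in> {0..t} \<Longrightarrow> (E has_vector_derivative e s) (at s within {0..t})"
proof
  define E where "E s = (\<Sum>b\<in>B. integral {0..s} (\<lambda>r. a (e r) b) *\<^sub>R b)" for s
  note fin = orthonormal_basisD(1)[OF B] and spn = orthonormal_basisD(2)[OF B]
    and BV = orthonormal_basisD(4)[OF B]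
  show "E s \<in> V" for s
    unfolding E_def spn[symmetric] by (intro span_sum span_scale span_base)
  show "E 0 = 0" by (simp add: E_def)
  fix s assume s: "s \<in> {0..t}"
  have "continuous_on {0..t} (\<lambda>r. a (e r) b)" if "b \<in> B" for b
    by (rule DERIV_continuous_on)
      (rule lin_on_has_real_derivative[OF fin spn bilin_on_left[OF inner_on_bilin[OF a] BV[OF that]] e(2) e(1) e(3)])
  then have "(E has_vector_derivative (\<Sum>b\<in>B. a (e s) b *\<^sub>R b)) (at s within {0..t})"
    unfolding E_def using s
    by (intro has_vector_derivative_sum)
      (auto intro!: derivative_eq_intros integral_has_vector_derivative
        simp: has_real_derivative_iff_has_vector_derivative)
  then show "(E has_vector_derivative e s) (at s within {0..t})"
    using orthonormal_expansion[OF a B e(1)[OF s]] by simp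
qed

text \<open>Otherwise both \<open>x\<close> and \<open>x - z\<close> exceed \<open>y\<close>, so
  their product exceeds the square of \<open>y\<close>. This resolves the quadratic inequality for
  \<open>M\<close> in the energy estimate.\<close>

lemma le_of_square_le:
  fixes x y z :: real
  assumes "x\<^sup>2 \<le> y\<^sup>2 + z * x" "0 \<le> x" "0 \<le> y" "0 \<le> z"
  shows "x \<le> y + z"
proof (rule ccontr)
  assume "\<not> x \<le> y + z"
  then have "x > y + z" by simp
  then have "x * (x - z) > y * y"
    using assms by (intro mult_strict_mono') auto
  then show False using assms(1) by (simp add: power2_eq_square algebra_simps)
qed

text \<open>\<open>L\<close> bounds the dual norm of the integrated functional at time 0.
  \<open>n\<close> may be any integrable majorant of the dual norm of the defect, a freedom that the
  \<open>L2\<close> version exploits.\<close>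

lemma energy_estimate:
  fixes m a b :: "'x::real_normed_vector \<Rightarrow> 'x \<Rightarrow> real"
  assumes a: "inner_on V a" and m: "inner_on V m" and b: "bilin_on V V b"
    and B: "orthonormal_basis a V B"
    and \<rho>: "0 \<le> \<rho>" "\<And>v. v \<in> V \<Longrightarrow> 0 \<le> b v v + \<rho> * m v v"
    and t: "0 \<le> t"
    and e: "\<And>s. s \<in> {0..t} \<Longrightarrow> e s \<in> V"
      "\<And>s. s \<in> {0..t} \<Longrightarrow> (e has_vector_derivative e' s) (at s within {0..t})"
    and e': "\<And>s. s \<in> {0..t} \<Longrightarrow> e' s \<in> V"
      "\<And>s. s \<in> {0..t} \<Longrightarrow> (e' has_vector_derivative e'' s) (at s within {0..t})"
    and e'': "\<And>s. s \<in> {0..t} \<Longrightarrow> e'' s \<in> V"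
    and eq: "\<And>s v. s \<in> {0..t} \<Longrightarrow> v \<in> V \<Longrightarrow>
      m (e'' s) v + b (e' s) v + a (e s) v = - m (d s) v"
    and n: "n integrable_on {0..t}" "\<And>s. s \<in> {0..t} \<Longrightarrow> 0 \<le> n s"
      "\<And>s v. s \<in> {0..t} \<Longrightarrow> v \<in> V \<Longrightarrow> \<bar>m (d s) v\<bar> \<le> n s * form_norm a v"
    and \<Delta>: "integral {0..t} n \<le> \<Delta>"
    and L: "0 \<le> L" "\<And>v. v \<in> V \<Longrightarrow> \<bar>m (e' 0) v + b (e 0) v\<bar> \<le> L * form_norm a v"
  shows "form_norm m (e t) \<le> exp (\<rho> * t) * (form_norm m (e 0) + 8 * (L + \<Delta>))"
proof -
  note mb = inner_on_bilin[OF m] and ab = inner_on_bilin[OF a]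
  obtain E where E: "\<And>s. E s \<in> V" "E 0 = 0"
    "\<And>s. s \<in> {0..t} \<Longrightarrow> (E has_vector_derivative e s) (at s within {0..t})"
    using primitive_on_subspace[OF a B e e'(1)] by blast
  note fin = orthonormal_basisD(1)[OF B] and spn = orthonormal_basisD(2)[OF B]
  have V0: "0 \<in> V" using orthonormal_basisD(3)[OF B] by (rule subspace_0)
  note der = bilin_on_has_real_derivative[OF a B]
  note lder = lin_on_has_real_derivative[OF fin spn]
  define G where "G = L + \<Delta>"
  have "0 \<le> integral {0..t} n" using n by (intro integral_nonneg) auto
  then have \<Delta>0: "0 \<le> \<Delta>" using \<Delta> by simp
  then have G0: "0 \<le> G" using L(1) by (simp add: G_def)
  define g where "g s v = m (e' s) v + b (e s) v + a (E s) v" for s v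
  have g0: "\<bar>g 0 v\<bar> \<le> L * form_norm a v" if "v \<in> V" for v
    using L(2)[OF that] lin_on_zero[OF bilin_on_left[OF ab that] V0] by (simp add: g_def E(2))
  \<comment> \<open>Since \<open>E\<close> has derivative \<open>e\<close>, differentiating
    \<open>g\<close> for fixed \<open>v\<close> restores the left-hand side of the equation.\<close>
  have g_der: "((\<lambda>s. g s v) has_real_derivative - m (d s) v) (at s within {0..t})"
    if "s \<in> {0..t}" "v \<in> V" for s v
    unfolding g_def eq[OF that, symmetric]
    by (intro DERIV_add lder[OF bilin_on_left[OF mb that(2)] e'(2) e'(1) e'']
        lder[OF bilin_on_left[OF b that(2)] e(2) e(1) e'(1)]
        lder[OF bilin_on_left[OF ab that(2)] E(3) E(1) e(1)] that)
  \<comment> \<open>With \<open>v\<close> frozen this is a scalar estimate in time: \<open>L\<close>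
    for the start, \<open>\<Delta>\<close> for the accumulated defect, applied to \<open>g\<close>
    and to \<open>- g\<close> to obtain the absolute value.\<close>
  have g_bound: "\<bar>g s v\<bar> \<le> G * form_norm a v" if s: "s \<in> {0..t}" and v: "v \<in> V" for s v
  proof -
    have sub: "{0..s} \<subseteq> {0..t}" using s by auto
    have ns: "n integrable_on {0..s}" using integrable_on_subinterval[OF n(1) sub] .
    have "integral {0..s} n \<le> integral {0..t} n"
      using sub ns n by (intro integral_subset_le) auto
    then have ns2: "integral {0..s} (\<lambda>r. n r * form_norm a v) \<le> \<Delta> * form_norm a v"
      using \<Delta> a v by (simp add: mult_right_mono)
    have int: "(\<lambda>r. n r * form_norm a v) integrable_on {0..s}"
      using ns by (rule integrable_on_mult_left)
    have d: "((\<lambda>s. g s v) has_real_derivative - m (d r) v) (at r within {0..s})"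
      if "r \<in> {0..s}" for r
      using g_der[of r v] that sub v by (meson DERIV_subset subsetD)
    have mb': "\<bar>m (d r) v\<bar> \<le> n r * form_norm a v" if "r \<in> {0..s}" for r
      using n(3)[of r v] that sub v by auto
    have "g s v - g 0 v \<le> integral {0..s} (\<lambda>r. n r * form_norm a v)"
      using s mb' by (intro increment_le_integral[OF _ d _ int]) force+
    moreover have "- g s v - (- g 0 v) \<le> integral {0..s} (\<lambda>r. n r * form_norm a v)"
      using s mb' by (intro increment_le_integral[OF _ DERIV_minus[OF d] _ int]) force+
    ultimately show ?thesis
      using g0[OF v] ns2 by (simp add: G_def distrib_right abs_le_iff)
  qed
  have me_der: "((\<lambda>s. m (e s) (e s)) has_real_derivative m (e' s) (e s) + m (e s) (e' s))
      (at s within {0..t})" if "s \<in> {0..t}" for s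
    using that e e'(1) by (intro der[OF mb]) auto
  have aE_der: "((\<lambda>s. a (E s) (E s)) has_real_derivative a (e s) (E s) + a (E s) (e s))
      (at s within {0..t})" if "s \<in> {0..t}" for s
    using that e(1) E by (intro der[OF ab]) auto
  \<comment> \<open>Now the argument moves as well, which produces the additional term
    \<open>g s (e s)\<close>.\<close>
  have gE_der: "((\<lambda>s. g s (E s)) has_real_derivative - m (d s) (E s) + g s (e s))
      (at s within {0..t})" if s: "s \<in> {0..t}" for s
  proof -
    have "((\<lambda>s. g s (E s)) has_real_derivative
        (m (e'' s) (E s) + m (e' s) (e s)) + (b (e' s) (E s) + b (e s) (e s))
          + (a (e s) (E s) + a (E s) (e s))) (at s within {0..t})"
      unfolding g_def using s e e' e'' E by (intro DERIV_add der mb ab b) auto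
    then show ?thesis
      by (rule DERIV_cong) (use eq[OF s E(1)[of s]] in \<open>simp add: g_def algebra_simps\<close>)
  qed
  define Y where "Y s = exp (- \<rho> * s)^2 * (m (e s) (e s) + a (E s) (E s))" for s
  have "continuous_on {0..t} Y"
    unfolding Y_def
    by (intro continuous_intros DERIV_continuous_on[OF me_der] DERIV_continuous_on[OF aE_der])
  then obtain \<tau> where \<tau>: "\<tau> \<in> {0..t}" "\<And>s. s \<in> {0..t} \<Longrightarrow> Y s \<le> Y \<tau>"
    using continuous_attains_sup[of "{0..t}" Y] t by auto
  have nonneg: "0 \<le> m (e s) (e s)" "0 \<le> a (E s) (E s)" if "s \<in> {0..t}" for s
    using inner_on_nonneg[OF m] inner_on_nonneg[OF a] e(1) E(1) that by auto
  define M where "M = sqrt (Y \<tau>)"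
  have "0 \<le> Y \<tau>" using nonneg[OF \<tau>(1)] by (simp add: Y_def)
  then have M2: "M\<^sup>2 = Y \<tau>" and M0: "0 \<le> M" by (simp_all add: M_def)
  have e_M: "exp (- \<rho> * s) * form_norm m (e s) \<le> M" if s: "s \<in> {0..t}" for s
  proof (rule power2_le_imp_le[OF _ M0])
    have "(exp (- \<rho> * s) * form_norm m (e s))\<^sup>2 \<le> Y s"
      using nonneg[OF s] form_norm_sq[OF m e(1)[OF s]]
      by (simp add: Y_def power_mult_distrib distrib_left)
    then show "(exp (- \<rho> * s) * form_norm m (e s))\<^sup>2 \<le> M\<^sup>2" using \<tau>(2)[OF s] M2 by simp
  qed
  have E_M: "exp (- \<rho> * s) * form_norm a (E s) \<le> M" if s: "s \<in> {0..t}" for s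
  proof (rule power2_le_imp_le[OF _ M0])
    have "(exp (- \<rho> * s) * form_norm a (E s))\<^sup>2 \<le> Y s"
      using nonneg[OF s] form_norm_sq[OF a E(1)[of s]]
      by (simp add: Y_def power_mult_distrib distrib_left)
    then show "(exp (- \<rho> * s) * form_norm a (E s))\<^sup>2 \<le> M\<^sup>2" using \<tau>(2)[OF s] M2 by simp
  qed
  have p1: "exp (- \<rho> * s) \<le> 1" if "s \<in> {0..t}" for s using that \<rho>(1) by simp
  have gE_M: "exp (- \<rho> * s) * \<bar>g s (E s)\<bar> \<le> G * M" if s: "s \<in> {0..t}" for s
  proof -
    have "exp (- \<rho> * s) * \<bar>g s (E s)\<bar> \<le> exp (- \<rho> * s) * (G * form_norm a (E s))"
      by (intro mult_left_mono g_bound s E(1)) simp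
    also have "\<dots> = G * (exp (- \<rho> * s) * form_norm a (E s))" by simp
    also have "\<dots> \<le> G * M" by (intro mult_left_mono E_M s G0)
    finally show ?thesis .
  qed
  text \<open>
    Subtracting \<open>2 g(E)\<close> from the energy is the integration by parts; the last term of \<open>R\<close> absorbs
    the contribution \<open>4 \<rho> e\<^sup>-\<^sup>2\<^sup>\<rho>\<^sup>s g(E)\<close> that the weight produces.
  \<close>
  define R where "R s = exp (- \<rho> * s)^2 * (m (e s) (e s) + a (E s) (E s) - 2 * g s (E s))
      + 4 * G * M * exp (- \<rho> * s)" for s
  define R' where "R' s = - 2 * \<rho> * exp (- \<rho> * s)^2 * (m (e s) (e s) + a (E s) (E s) - 2 * g s (E s))
      + exp (- \<rho> * s)^2 * (2 * m (e' s) (e s) + 2 * a (E s) (e s)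
          - 2 * (- m (d s) (E s) + g s (e s)))
      - 4 * G * M * \<rho> * exp (- \<rho> * s)" for s
  have R_der: "(R has_real_derivative R' s) (at s within {0..t})" if s: "s \<in> {0..t}" for s
    unfolding R_def R'_def
    by (rule derivative_eq_intros me_der[OF s] aE_der[OF s] gE_der[OF s] refl)+
      (use inner_on_sym[OF m e(1)[OF s] e'(1)[OF s]] inner_on_sym[OF a E(1)[of s] e(1)[OF s]]
        in \<open>simp add: algebra_simps power2_eq_square\<close>)
  have R'_le: "R' s \<le> 2 * M * n s" if s: "s \<in> {0..t}" for s
  proof -
    define p where "p = exp (- \<rho> * s)"
    have p: "0 < p" "p \<le> 1" using p1[OF s] by (auto simp: p_def)
    \<comment> \<open>Unfolding \<open>g s (e s)\<close> cancels the terms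
      \<open>m (e' s) (e s)\<close> and \<open>a (E s) (e s)\<close>. What remains of it is
      \<open>- 2 * b (e s) (e s)\<close>, and the derivative of the weight completes it to the
      quasi-monotone form. The first three summands turn out to be nonpositive; only the defect term
      contributes.\<close>
    have "R' s = - 2 * p\<^sup>2 * (b (e s) (e s) + \<rho> * m (e s) (e s)) - 2 * \<rho> * p\<^sup>2 * a (E s) (E s)
        + 4 * \<rho> * p * (p * g s (E s) - G * M) + 2 * p * (p * m (d s) (E s))"
      unfolding R'_def p_def[symmetric] by (simp add: g_def algebra_simps power2_eq_square)
    moreover have "0 \<le> p\<^sup>2 * (b (e s) (e s) + \<rho> * m (e s) (e s))"
      using \<rho>(2)[OF e(1)[OF s]] by simp
    moreover have "0 \<le> \<rho> * p\<^sup>2 * a (E s) (E s)" using \<rho>(1) nonneg(2)[OF s] by simp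
    moreover have "4 * \<rho> * p * (p * g s (E s) - G * M) \<le> 0"
    proof -
      have "p * g s (E s) \<le> p * \<bar>g s (E s)\<bar>" using p by (intro mult_left_mono) auto
      then have "p * g s (E s) - G * M \<le> 0" using gE_M[OF s, folded p_def] by linarith
      then show ?thesis using \<rho>(1) p by (intro mult_nonneg_nonpos) auto
    qed
    moreover have "2 * p * (p * m (d s) (E s)) \<le> 2 * M * n s"
    proof -
      have "p * m (d s) (E s) \<le> p * (n s * form_norm a (E s))"
        using n(3)[OF s E(1)[of s]] p by (intro mult_left_mono) auto
      also have "\<dots> = n s * (p * form_norm a (E s))" by simp
      also have "\<dots> \<le> n s * M" using E_M[OF s] n(2)[OF s] by (intro mult_left_mono) (auto simp: p_def)
      finally have "p * (p * m (d s) (E s)) \<le> p * (n s * M)" using p by (intro mult_left_mono) auto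
      also have "\<dots> \<le> 1 * (n s * M)" using p n(2)[OF s] M0 by (intro mult_right_mono) auto
      finally show ?thesis by (simp add: mult.commute)
    qed
    ultimately show ?thesis by linarith
  qed
  have sub: "{0..\<tau>} \<subseteq> {0..t}" using \<tau> by auto
  have nt: "n integrable_on {0..\<tau>}" using integrable_on_subinterval[OF n(1) sub] .
  have "integral {0..\<tau>} n \<le> integral {0..t} n"
    using sub nt n by (intro integral_subset_le) auto
  then have int_n: "integral {0..\<tau>} n \<le> \<Delta>" using \<Delta> by simp
  \<comment> \<open>Integration stops at the maximiser \<open>\<tau>\<close>, where the weighted
    energy equals \<open>M\<^sup>2\<close>.\<close>
  have "R \<tau> - R 0 \<le> integral {0..\<tau>} (\<lambda>s. 2 * M * n s)"
  proof (rule increment_le_integral)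
    show "(R has_real_derivative R' s) (at s within {0..\<tau>})" if "s \<in> {0..\<tau>}" for s
      using R_der that sub by (meson DERIV_subset subsetD)
  qed (use \<tau> sub R'_le nt in \<open>auto intro: integrable_on_mult_right\<close>)
  also have "\<dots> \<le> 2 * M * \<Delta>"
    using int_n M0 by (simp add: mult_left_mono)
  finally have "R \<tau> \<le> R 0 + 2 * M * \<Delta>" by simp
  \<comment> \<open>The primitive vanishes at 0, which removes both its energy and the value of
    \<open>g\<close> on it.\<close>
  moreover have "R 0 = (form_norm m (e 0))\<^sup>2 + 4 * G * M"
  proof -
    have "0 \<in> {0..t}" using t by simp
    then show ?thesis
      using form_norm_sq[OF m e(1)] lin_on_zero[OF bilin_on_right[OF ab V0] V0]
        lin_on_zero[OF bilin_on_right[OF mb e'(1)] V0] lin_on_zero[OF bilin_on_right[OF b e(1)] V0]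
      by (simp add: R_def g_def E(2))
  qed
  moreover have "M\<^sup>2 - 2 * G * M \<le> R \<tau>"
  proof -
    define p where "p = exp (- \<rho> * \<tau>)"
    have p: "0 < p" "p \<le> 1" using p1[OF \<tau>(1)] by (auto simp: p_def)
    have "p * g \<tau> (E \<tau>) \<le> p * \<bar>g \<tau> (E \<tau>)\<bar>" using p by (intro mult_left_mono) auto
    then have "p * g \<tau> (E \<tau>) \<le> G * M" using gE_M[OF \<tau>(1), folded p_def] by linarith
    then have "p * (p * g \<tau> (E \<tau>)) \<le> p * (G * M)" using p by (intro mult_left_mono) auto
    also have "\<dots> \<le> 1 * (G * M)" using p G0 M0 by (intro mult_right_mono) auto
    finally have "p\<^sup>2 * g \<tau> (E \<tau>) \<le> G * M" by (simp add: power2_eq_square)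
    moreover have "R \<tau> = M\<^sup>2 - 2 * (p\<^sup>2 * g \<tau> (E \<tau>)) + 4 * G * M * p"
      unfolding R_def M2 Y_def p_def[symmetric] by (simp add: algebra_simps)
    moreover have "0 \<le> 4 * G * M * p" using G0 M0 p by simp
    ultimately show ?thesis by linarith
  qed
  moreover have "2 * M * \<Delta> \<le> 2 * G * M" using mult_nonneg_nonneg[OF L(1) M0] by (simp add: G_def distrib_left distrib_right mult.commute)
  \<comment> \<open>The factor 8 collects 4 from \<open>R 0\<close>, 2 from the defect integral and
    2 from the term with \<open>g\<close> at \<open>\<tau>\<close>.\<close>
  ultimately have "M\<^sup>2 \<le> (form_norm m (e 0))\<^sup>2 + 8 * G * M" by linarith
  moreover have "0 \<le> form_norm m (e 0)"
    by (rule form_norm_nonneg[OF m e(1)]) (use t in simp)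
  moreover have "0 \<le> 8 * G" using G0 by simp
  ultimately have M_le: "M \<le> form_norm m (e 0) + 8 * G"
    using M0 by (metis le_of_square_le)
  have "exp (- \<rho> * t) * form_norm m (e t) \<le> form_norm m (e 0) + 8 * G"
    using t by (intro order_trans[OF e_M M_le]) simp
  then have "exp (\<rho> * t) * (exp (- \<rho> * t) * form_norm m (e t)) \<le>
      exp (\<rho> * t) * (form_norm m (e 0) + 8 * G)"
    by (rule mult_left_mono) simp
  moreover have "exp (\<rho> * t) * (exp (- \<rho> * t) * form_norm m (e t)) = form_norm m (e t)"
    by (simp add: exp_minus)
  ultimately show ?thesis by (simp only: G_def)
qed

lemma energy_estimate_L2:
  fixes m a b :: "'x::real_normed_vector \<Rightarrow> 'x \<Rightarrow> real"
  assumes a: "inner_on V a" and m: "inner_on V m" and b: "bilin_on V V b"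
    and B: "orthonormal_basis a V B"
    and \<rho>: "0 \<le> \<rho>" "\<And>v. v \<in> V \<Longrightarrow> 0 \<le> b v v + \<rho> * m v v"
    and t: "0 \<le> t"
    and e: "\<And>s. s \<in> {0..t} \<Longrightarrow> e s \<in> V"
      "\<And>s. s \<in> {0..t} \<Longrightarrow> (e has_vector_derivative e' s) (at s within {0..t})"
    and e': "\<And>s. s \<in> {0..t} \<Longrightarrow> e' s \<in> V"
      "\<And>s. s \<in> {0..t} \<Longrightarrow> (e' has_vector_derivative e'' s) (at s within {0..t})"
    and e'': "\<And>s. s \<in> {0..t} \<Longrightarrow> e'' s \<in> V"
    and eq: "\<And>s v. s \<in> {0..t} \<Longrightarrow> v \<in> V \<Longrightarrow>
      m (e'' s) v + b (e' s) v + a (e s) v = - m (d s) v"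
    and N: "(\<lambda>s. (N s)\<^sup>2) integrable_on {0..t}"
      "\<And>s v. s \<in> {0..t} \<Longrightarrow> v \<in> V \<Longrightarrow> \<bar>m (d s) v\<bar> \<le> N s * form_norm a v"
    and L: "0 \<le> L" "\<And>v. v \<in> V \<Longrightarrow> \<bar>m (e' 0) v + b (e 0) v\<bar> \<le> L * form_norm a v"
  shows "form_norm m (e t) \<le>
    exp (\<rho> * t) * (form_norm m (e 0) + 8 * (L + sqrt (t * integral {0..t} (\<lambda>s. (N s)\<^sup>2))))"
proof (cases "t = 0")
  \<comment> \<open>The choice of \<open>\<kappa>\<close> below needs \<open>t\<close> positive;
    here only \<open>0 \<le> L\<close> is left to use.\<close>
  case True
  then show ?thesis using L(1) by simp
next
  case False
  define I where "I = integral {0..t} (\<lambda>s. (N s)\<^sup>2)"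
  have I: "0 \<le> I" unfolding I_def using N(1) by (intro integral_nonneg) auto
  have t0: "0 < t" using False t by simp
  have est: "form_norm m (e t) \<le> exp (\<rho> * t) * (form_norm m (e 0) + 8 * (L + (sqrt (t * I) + \<eta>)))"
    if \<eta>: "0 < \<eta>" for \<eta>
  proof -
    define \<Delta> where "\<Delta> = sqrt (t * I) + \<eta>"
    define \<kappa> where "\<kappa> = \<Delta> / t"
    text \<open>
      Young's inequality replaces Cauchy-Schwarz, so that integrability of \<open>N\<close> itself is not needed;
      \<open>\<eta>\<close> keeps \<open>\<kappa>\<close> positive.
    \<close>
    define n where "n s = \<kappa> / 2 + (N s)\<^sup>2 / (2 * \<kappa>)" for s
    have \<Delta>: "0 < \<Delta>" using \<eta> t I by (simp add: \<Delta>_def add_nonneg_pos)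
    then have \<kappa>: "0 < \<kappa>" using t0 by (simp add: \<kappa>_def)
    have N_le: "N s \<le> n s" for s
      using \<kappa> sum_squares_bound[of \<kappa> "N s"] by (simp add: n_def field_simps power2_eq_square)
    have int: "(n has_integral \<kappa> / 2 * t + I / (2 * \<kappa>)) {0..t}"
      unfolding n_def I_def using has_integral_const_real[of "\<kappa> / 2" 0 t] t
      by (intro has_integral_add has_integral_divide integrable_integral N(1)) (simp_all add: mult.commute)
    \<comment> \<open>\<open>\<kappa> = \<Delta> / t\<close> balances the two parts of Young's
      inequality: the constant part integrates to \<open>\<Delta> / 2\<close>, and this bound makes
      the quadratic part at most \<open>\<Delta> / 2\<close>.\<close>
    have "t * I \<le> \<Delta>\<^sup>2"
      using \<eta> t I unfolding \<Delta>_def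
      by (metis add_increasing2 less_imp_le mult_nonneg_nonneg order_refl power_mono real_sqrt_ge_zero real_sqrt_pow2)
    then have "I / (2 * \<kappa>) \<le> \<Delta> / 2"
      using t0 \<Delta> by (simp add: \<kappa>_def field_simps power2_eq_square)
    then have "integral {0..t} n \<le> \<Delta>"
      using integral_unique[OF int] t0 by (simp add: \<kappa>_def)
    moreover have "\<bar>m (d s) v\<bar> \<le> n s * form_norm a v" if "s \<in> {0..t}" "v \<in> V" for s v
      using N(2)[OF that] mult_right_mono[OF N_le form_norm_nonneg[OF a that(2)], of s] by linarith
    ultimately show ?thesis
      using \<kappa> unfolding \<Delta>_def[symmetric]
      by (intro energy_estimate[OF a m b B \<rho> t e e' e'' eq has_integral_integrable[OF int] _ _ _ L])
        (auto simp: n_def)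
  qed
  \<comment> \<open>The slack \<open>\<eta>\<close> is divided by its prefactor
    \<open>8 * exp (\<rho> * t)\<close>, so that exactly \<open>\<epsilon>\<close> remains.\<close>
  have "form_norm m (e t) \<le> exp (\<rho> * t) * (form_norm m (e 0) + 8 * (L + sqrt (t * I))) + \<epsilon>"
    if "0 < \<epsilon>" for \<epsilon>
    using est[of "\<epsilon> / (8 * exp (\<rho> * t))"] that by (simp add: distrib_left)
  then show ?thesis unfolding I_def by (rule field_le_epsilon)
qed

section \<open>Ritz map and dual norms\<close>

text \<open>The Riesz representer solves the defining equation, and definiteness of
  \<open>ah\<close> makes the solution unique. The coordinate form exhibits how the Ritz map depends
  on \<open>u\<close>.\<close>

lemma ritz_eq:
  assumes ah: "inner_on V ah" and B: "orthonormal_basis ah V B"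
    and F: "lin_on V (\<lambda>v. a u (l v))"
  shows "ritz a V ah l u = (\<Sum>b\<in>B. a u (l b) *\<^sub>R b)" (is "_ = ?r")
  unfolding ritz_def
proof (rule the_equality)
  note sub = orthonormal_basisD(3)[OF B]
  have r: "?r \<in> V"
    by (intro subspace_sum[OF sub] subspace_scale[OF sub] orthonormal_basisD(4)[OF B])
  have r_eq: "ah ?r v = a u (l v)" if "v \<in> V" for v
    by (rule inner_on_representation[OF ah B F that])
  show "?r \<in> V \<and> (\<forall>v\<in>V. ah ?r v = a u (l v))" using r r_eq by blast
  fix w assume w: "w \<in> V \<and> (\<forall>v\<in>V. ah w v = a u (l v))"
  then have wr: "w - ?r \<in> V" using r by (blast intro: subspace_diff[OF sub])
  have "ah (w - ?r) (w - ?r) = 0"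
    using lin_on_diff[OF bilin_on_left[OF inner_on_bilin[OF ah] wr] sub, of w ?r] w r r_eq wr by simp
  moreover have "w - ?r \<noteq> 0 \<Longrightarrow> 0 < ah (w - ?r) (w - ?r)"
    using ah wr unfolding inner_on_def by blast
  ultimately show "w = ?r" by (metis less_irrefl right_minus_eq)
qed

text \<open>Cauchy-Schwarz bounds each orthonormal coordinate of \<open>v\<close> by its norm. The
  result supplies the boundedness without which the supremum in \<open>sup_quotient\<close> would be
  unspecified.\<close>

lemma lin_on_form_norm_bounded:
  fixes F :: "'a::real_vector \<Rightarrow> real"
  assumes a: "inner_on V a" and B: "orthonormal_basis a V B" and F: "lin_on V F"
  shows "\<exists>K. \<forall>v\<in>V. \<bar>F v\<bar> \<le> K * form_norm a v"
proof (intro exI ballI)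
  note sub = orthonormal_basisD(3)[OF B] and BV = orthonormal_basisD(4)[OF B]
  fix v assume v: "v \<in> V"
  have "F v = (\<Sum>b\<in>B. a v b * F b)"
    using lin_on_sum[OF F sub BV, where I = B and x = "\<lambda>b. b" and c = "a v"]
      orthonormal_expansion[OF a B v] by simp
  also have "\<bar>\<dots>\<bar> \<le> (\<Sum>b\<in>B. \<bar>F b\<bar> * form_norm a v)"
  proof (rule sum_abs[THEN order_trans], rule sum_mono)
    fix b assume b: "b \<in> B"
    have "\<bar>a v b\<bar> \<le> form_norm a v"
      using inner_on_Cauchy_Schwarz[OF a sub v BV[OF b]] orthonormal_basisD(5)[OF B b b]
      by (simp add: form_norm_def)
    then show "\<bar>a v b * F b\<bar> \<le> \<bar>F b\<bar> * form_norm a v"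
      by (simp add: abs_mult mult.commute[of "\<bar>F b\<bar>"] mult_right_mono)
  qed
  finally show "\<bar>F v\<bar> \<le> (\<Sum>b\<in>B. \<bar>F b\<bar>) * form_norm a v" by (simp add: sum_distrib_right)
qed

text \<open>Boundedness of the quotients makes the supremum a genuine upper bound, and the inserted
  0 makes it nonnegative. The one-sided bound, applied to \<open>v\<close> and \<open>- v\<close>,
  gives the absolute value.\<close>

lemma sup_quotient_bounds:
  fixes F :: "'a::real_vector \<Rightarrow> real"
  assumes a: "inner_on V a" and V: "subspace V" and F: "lin_on V F"
    and bdd: "\<exists>K. \<forall>v\<in>V. \<bar>F v\<bar> \<le> K * form_norm a v"
  shows sup_quotient_nonneg: "0 \<le> sup_quotient V (form_norm a) F"
    and sup_quotient_bound: "v \<in> V \<Longrightarrow> \<bar>F v\<bar> \<le> sup_quotient V (form_norm a) F * form_norm a v"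
proof -
  let ?Q = "insert 0 {F v / form_norm a v | v. v \<in> V \<and> v \<noteq> 0}"
  obtain K where K: "\<And>v. v \<in> V \<Longrightarrow> \<bar>F v\<bar> \<le> K * form_norm a v" using bdd by blast
  have quot: "F v / form_norm a v \<le> max 0 K" if "v \<in> V" "v \<noteq> 0" for v
  proof -
    have "F v / form_norm a v \<le> K"
      using K[OF that(1)] form_norm_pos[OF a that] by (simp add: pos_divide_le_eq abs_le_iff)
    then show ?thesis by simp
  qed
  have bd: "bdd_above ?Q" by (rule bdd_aboveI[of _ "max 0 K"]) (use quot in auto)
  show "0 \<le> sup_quotient V (form_norm a) F"
    unfolding sup_quotient_def by (rule cSup_upper[OF _ bd]) simp
  have le: "F v \<le> sup_quotient V (form_norm a) F * form_norm a v" if v: "v \<in> V" for v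
  proof (cases "v = 0")
    case True
    then show ?thesis
      using lin_on_zero[OF F subspace_0[OF V]] K[OF v] \<open>0 \<le> sup_quotient V (form_norm a) F\<close>
        form_norm_nonneg[OF a v] by simp
  next
    case False
    have "F v / form_norm a v \<le> sup_quotient V (form_norm a) F"
      unfolding sup_quotient_def by (rule cSup_upper[OF _ bd]) (use v False in auto)
    then show ?thesis using form_norm_pos[OF a v False] by (simp add: pos_divide_le_eq)
  qed
  show "v \<in> V \<Longrightarrow> \<bar>F v\<bar> \<le> sup_quotient V (form_norm a) F * form_norm a v"
  proof -
    assume v: "v \<in> V"
    have nv: "-1 *\<^sub>R v \<in> V" using V v by (rule subspace_scale)
    have "a (- v) (- v) = a v v"
      using lin_on_scaleR[OF bilin_on_left[OF inner_on_bilin[OF a] nv] v, of "-1"]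
        lin_on_scaleR[OF bilin_on_right[OF inner_on_bilin[OF a] v] v, of "-1"] by simp
    then have "form_norm a (- v) = form_norm a v" by (simp add: form_norm_def)
    then show ?thesis
      using le[OF v] le[OF nv] lin_on_scaleR[OF F v, of "-1"] by (simp add: abs_le_iff)
  qed
qed

section \<open>Energy dual norm of the form \<open>b\<close>\<close>

context wave_setting
begin

lemma inner_on_a: "inner_on UNIV a"
proof -
  interpret a: bounded_bilinear a by (rule a_continuous)
  obtain \<alpha> where "\<alpha> > 0" "\<And>v. \<alpha> * (norm v)\<^sup>2 \<le> a v v" using a_coercive by blast
  then have "0 < a v v" if "v \<noteq> 0" for v
    using that by (smt (verit) mult_pos_pos zero_less_norm_iff zero_less_power)
  then show ?thesis
    using a_symmetric
    by (simp add: inner_on_def bilin_on_def lin_on_def a.add_left a.add_right a.scaleR_left a.scaleR_right)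
qed

text \<open>Coercivity bounds the Hilbert norm by the energy norm up to
  \<open>1 / sqrt \<alpha>\<close>, so continuity of \<open>b\<close> yields a finite dual
  norm.\<close>

lemma dual_norm_form_op_bounds:
  shows dual_norm_form_op_nonneg: "0 \<le> dual_norm a (form_op b w)"
    and dual_norm_form_op_bound: "\<bar>b w v\<bar> \<le> dual_norm a (form_op b w) * form_norm a v"
proof -
  interpret b: bounded_bilinear b by (rule b_continuous)
  obtain K where K: "K \<ge> 0" "\<And>x y. norm (b x y) \<le> norm x * norm y * K"
    using b.nonneg_bounded by blast
  obtain \<alpha> where \<alpha>: "\<alpha> > 0" "\<And>v. \<alpha> * (norm v)\<^sup>2 \<le> a v v" using a_coercive by blast
  have "\<bar>b w v\<bar> \<le> norm w * K / sqrt \<alpha> * form_norm a v" for v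
  proof -
    have "sqrt \<alpha> * norm v \<le> form_norm a v"
      unfolding form_norm_def using real_sqrt_le_mono[OF \<alpha>(2)[of v]] by (simp add: real_sqrt_mult)
    then have "norm v \<le> form_norm a v / sqrt \<alpha>" using \<alpha>(1) by (simp add: field_simps)
    then have "norm w * K * norm v \<le> norm w * K * (form_norm a v / sqrt \<alpha>)"
      using K(1) by (intro mult_left_mono) auto
    then show ?thesis using K(2)[of w v] by (simp add: mult_ac)
  qed
  then have bdd: "\<exists>K. \<forall>v\<in>UNIV. \<bar>b w v\<bar> \<le> K * form_norm a v" by blast
  have lin: "lin_on UNIV (b w)" by (simp add: lin_on_def b.add_right b.scaleR_right)
  have eq: "dual_norm a (form_op b w) = sup_quotient UNIV (form_norm a) (b w)"
    by (simp add: dual_norm_def form_op_apply[OF b_continuous] sup_quotient_def)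
  show "0 \<le> dual_norm a (form_op b w)" "\<bar>b w v\<bar> \<le> dual_norm a (form_op b w) * form_norm a v"
    unfolding eq using sup_quotient_bounds[OF inner_on_a subspace_UNIV lin bdd] by auto
qed

end

section \<open>Ritz map and the perturbation of the form \<open>b\<close>\<close>

context semi_discrete_setting
begin

lemma Vh_basis: "\<exists>B. orthonormal_basis (ah h) (Vh h) B"
  using Vh_finite_dim[of h] ah_inner[of h] inner_on_orthonormal_basis by metis

lemma lift_linear_Vh: "lin_on (Vh h) (lft h)"
  using lift_linear Vh_subset_W by (rule lin_on_subset)

lemma bh_bilinear_Vh: "bilin_on (Vh h) (Vh h) (bh h)"
  using bh_bilinear Vh_subset_W order_refl by (rule bilin_on_subset)

lemma lin_on_a_lift: "lin_on (Vh h) (\<lambda>v. a w (lft h v))"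
proof -
  interpret a: bounded_bilinear a by (rule a_continuous)
  show ?thesis
    using lift_linear_Vh[of h] by (simp add: lin_on_def a.add_right a.scaleR_right)
qed

lemma ritz_expansion:
  assumes "orthonormal_basis (ah h) (Vh h) B"
  shows "ritz a (Vh h) (ah h) (lft h) w = (\<Sum>b\<in>B. a w (lft h b) *\<^sub>R b)"
  by (rule ritz_eq) (fact ah_inner assms lin_on_a_lift)+

lemma ritz_in_Vh: "ritz a (Vh h) (ah h) (lft h) w \<in> Vh h"
proof -
  obtain B where B: "orthonormal_basis (ah h) (Vh h) B" using Vh_basis by blast
  show ?thesis
    unfolding ritz_expansion[OF B]
    by (intro subspace_sum subspace_scale orthonormal_basisD(3,4)[OF B])
qed

text \<open>In coordinates the Ritz map is a finite sum of bounded linear images of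
  \<open>u\<close>, so it commutes with the time derivative.\<close>

lemma ritz_has_vector_derivative:
  assumes "(u has_vector_derivative u') F"
  shows "((\<lambda>s. ritz a (Vh h) (ah h) (lft h) (u s)) has_vector_derivative
    ritz a (Vh h) (ah h) (lft h) u') F"
proof -
  interpret a: bounded_bilinear a by (rule a_continuous)
  obtain B where B: "orthonormal_basis (ah h) (Vh h) B" using Vh_basis by blast
  have "((\<lambda>s. a (u s) (lft h b) *\<^sub>R b) has_vector_derivative a u' (lft h b) *\<^sub>R b) F" for b
    by (rule bounded_linear.has_vector_derivative[OF _ assms])
      (intro bounded_linear_compose[OF bounded_linear_scaleR_left] a.bounded_linear_left)
  then show ?thesis
    unfolding ritz_expansion[OF B] by (intro has_vector_derivative_sum)
qed

lemma delta_form_linear: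
  assumes "w \<in> W h"
  shows "lin_on (Vh h) (delta_form b (bh h) (lft h) w)"
proof -
  interpret b: bounded_bilinear b by (rule b_continuous)
  show ?thesis
    using lift_linear_Vh[of h] bilin_on_right[OF bh_bilinear assms]
    by (simp add: lin_on_def delta_form_def b.add_right b.scaleR_right algebra_simps)
qed

text \<open>Replacing \<open>bh\<close> by \<open>b\<close> on the lifts costs exactly
  \<open>delta_form\<close>. The two summands are the source of the two kinds of damping terms in
  \<open>initial_error\<close>; \<open>C\<close> converts the energy norm of the lifted test
  function.\<close>

lemma bh_bound:
  assumes w: "w \<in> W h" and v: "v \<in> Vh h"
    and C: "form_norm a (lft h v) \<le> C * form_norm (ah h) v"
  shows "\<bar>bh h w v\<bar> \<le> (sup_quotient (Vh h) (form_norm (ah h)) (delta_form b (bh h) (lft h) w)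
    + C * dual_norm a (form_op b (lft h w))) * form_norm (ah h) v"
proof -
  obtain B where B: "orthonormal_basis (ah h) (Vh h) B" using Vh_basis by blast
  note \<Delta>lin = delta_form_linear[OF w]
  have "\<bar>delta_form b (bh h) (lft h) w v\<bar> \<le>
      sup_quotient (Vh h) (form_norm (ah h)) (delta_form b (bh h) (lft h) w) * form_norm (ah h) v"
    by (rule sup_quotient_bound[OF ah_inner Vh_subspace \<Delta>lin
          lin_on_form_norm_bounded[OF ah_inner B \<Delta>lin] v])
  moreover have "\<bar>b (lft h w) (lft h v)\<bar> \<le> dual_norm a (form_op b (lft h w)) * (C * form_norm (ah h) v)"
    using dual_norm_form_op_bound mult_left_mono[OF C dual_norm_form_op_nonneg] by (rule order_trans)
  moreover have "bh h w v = b (lft h w) (lft h v) - delta_form b (bh h) (lft h) w v"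
    by (simp add: delta_form_def)
  ultimately show ?thesis by (simp add: algebra_simps)
qed

end

section \<open>The error bound\<close>

context semi_discrete_setting
begin

text \<open>\<open>L\<close> stays a parameter here: the composition of the initial error enters
  only in \<open>wave_error_bound\<close>.\<close>

lemma error_stability:
  assumes T: "0 \<le> t" "t \<le> T"
    and u: "wave_solution j a b T f u0 u1 u u' u''"
    and uh: "semi_discrete_solution (Vh h) (mh h) (ah h) (bh h) T (\<lambda>t. Ih h (f t)) i0 i1 uh uh' uh''"
    and d: "is_defect a (Vh h) (mh h) (ah h) (bh h) (lft h) T (\<lambda>t. Ih h (f t)) u u' u'' d"
    and N: "(\<lambda>s. (defect_norm (Vh h) (mh h) (ah h) (d s))\<^sup>2) integrable_on {0..t}"
    and L: "0 \<le> L" "\<And>v. v \<in> Vh h \<Longrightarrow>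
      \<bar>mh h (i1 - ritz a (Vh h) (ah h) (lft h) u1) v + bh h (i0 - ritz a (Vh h) (ah h) (lft h) u0) v\<bar>
      \<le> L * form_norm (ah h) v"
  shows "form_norm (mh h) (uh t - ritz a (Vh h) (ah h) (lft h) (u t)) \<le> exp (\<rho>h * t) *
    (form_norm (mh h) (i0 - ritz a (Vh h) (ah h) (lft h) u0) + 8 * (L + sqrt (t *
       integral {0..t} (\<lambda>s. (defect_norm (Vh h) (mh h) (ah h) (d s))\<^sup>2))))"
proof -
  define R where "R = ritz a (Vh h) (ah h) (lft h)"
  note u = u[unfolded wave_solution_def] and uh = uh[unfolded semi_discrete_solution_def]
    and d = d[unfolded is_defect_def, folded R_def]
  obtain B where B: "orthonormal_basis (ah h) (Vh h) B" using Vh_basis by blast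
  note sub = Vh_subspace[of h]
  have RV: "R w \<in> Vh h" for w unfolding R_def by (rule ritz_in_Vh)
  have in_T: "s \<in> {0..T}" if "s \<in> {0..t}" for s using that T by auto
  have uhV: "uh s \<in> Vh h" "uh' s \<in> Vh h" "uh'' s \<in> Vh h" if "s \<in> {0..t}" for s
    using uh in_T[OF that] by auto
  have t_sub: "{0..t} \<subseteq> {0..T}" using T by auto
  have der: "((\<lambda>s. uh s - R (u s)) has_vector_derivative uh' s - R (u' s)) (at s within {0..t})"
    "((\<lambda>s. uh' s - R (u' s)) has_vector_derivative uh'' s - R (u'' s)) (at s within {0..t})"
    if s: "s \<in> {0..t}" for s
    using u uh in_T[OF s] unfolding R_def
    by (auto intro!: has_vector_derivative_diff ritz_has_vector_derivative
        intro: has_vector_derivative_within_subset[OF _ t_sub])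
  have "form_norm (mh h) (uh t - R (u t)) \<le> exp (\<rho>h * t) *
    (form_norm (mh h) (uh 0 - R (u 0)) + 8 * (L + sqrt (t *
       integral {0..t} (\<lambda>s. (defect_norm (Vh h) (mh h) (ah h) (d s))\<^sup>2))))"
  proof (rule energy_estimate_L2[OF ah_inner mh_inner bh_bilinear_Vh B \<rho>h_nonneg _ T(1) _ der(1) _ der(2) _ _ N])
    show "0 \<le> bh h v v + \<rho>h * mh h v v" if "v \<in> Vh h" for v
      using bh_quasi_monotone[of h] that by (simp add: monotone_form_on_def)
    fix s assume s: "s \<in> {0..t}"
    show "uh s - R (u s) \<in> Vh h" "uh' s - R (u' s) \<in> Vh h" "uh'' s - R (u'' s) \<in> Vh h"
      using uhV[OF s] RV subspace_diff[OF sub] by blast+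
    fix v assume v: "v \<in> Vh h"
    have "mh h (uh'' s) v + bh h (uh' s) v + ah h (uh s) v = mh h (Ih h (f s)) v"
      using uh in_T[OF s] v by blast
    moreover have "mh h (R (u'' s)) v + bh h (R (u' s)) v + ah h (R (u s)) v
        = mh h (Ih h (f s)) v + mh h (d s) v"
      using d in_T[OF s] v by blast
    ultimately show "mh h (uh'' s - R (u'' s)) v + bh h (uh' s - R (u' s)) v
        + ah h (uh s - R (u s)) v = - mh h (d s) v"
      using lin_on_diff[OF bilin_on_left[OF inner_on_bilin[OF mh_inner] v] sub uhV(3)[OF s] RV]
        lin_on_diff[OF bilin_on_left[OF inner_on_bilin[OF ah_inner] v] sub uhV(1)[OF s] RV]
        lin_on_diff[OF bilin_on_left[OF bh_bilinear_Vh v] sub uhV(2)[OF s] RV]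
      by simp
    have dV: "d s \<in> Vh h" using d in_T[OF s] by blast
    note lin = bilin_on_right[OF inner_on_bilin[OF mh_inner] dV]
    show "\<bar>mh h (d s) v\<bar> \<le> defect_norm (Vh h) (mh h) (ah h) (d s) * form_norm (ah h) v"
      unfolding defect_norm_def
      by (rule sup_quotient_bound[OF ah_inner sub lin lin_on_form_norm_bounded[OF ah_inner B lin] v])
  qed (use L u uh in \<open>simp_all add: R_def\<close>)
  then show ?thesis using u uh by (simp add: R_def)
qed

text \<open>All constants are explicit in those of the setting, so their independence of
  \<open>h\<close> can be read off. The constant \<open>c\<close> of the initial error is the lift
  constant \<open>C2\<close>.\<close>

lemma wave_error_bound:
  fixes h :: 'i
  assumes C1: "0 < C1" "\<And>v. v \<in> Vh h \<Longrightarrow> form_norm (mh h) v \<le> C1 * form_norm (ah h) v"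
    and C2: "0 < C2" "\<And>v. v \<in> Vh h \<Longrightarrow> form_norm a (lft h v) \<le> C2 * form_norm (ah h) v"
    and c3: "0 < c3" "\<And>v. v \<in> Vh h \<Longrightarrow> c3 * form_norm (mh h) v \<le> norm (blinfun_apply j (lft h v))"
    and C3: "0 < C3" "\<And>v. v \<in> Vh h \<Longrightarrow> norm (blinfun_apply j (lft h v)) \<le> C3 * form_norm (mh h) v"
    and T: "0 \<le> t" "t \<le> T"
    and u: "wave_solution j a b T f u0 u1 u u' u''"
    and uh: "semi_discrete_solution (Vh h) (mh h) (ah h) (bh h) T (\<lambda>t. Ih h (f t))
      (Ih h (to_dual j u0)) (Ih h (to_dual j u1)) uh uh' uh''"
    and d: "is_defect a (Vh h) (mh h) (ah h) (bh h) (lft h) T (\<lambda>t. Ih h (f t)) u u' u'' d"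
    and N: "(\<lambda>s. (defect_norm (Vh h) (mh h) (ah h) (d s))\<^sup>2) integrable_on {0..t}"
  shows "norm (blinfun_apply j (u t - lft h (uh t)))
     \<le> norm (blinfun_apply j (u t - lft h (ritz a (Vh h) (ah h) (lft h) (u t))))
       + 2 * C3 * (1 / c3 + 8 * C1 / c3 + 8) * exp (\<rho>h * T)
         * sqrt ((initial_error j a b (Vh h) (W h) (ah h) (bh h) (lft h) (Ih h) C2 u0 u1)\<^sup>2
                 + T * integral {0..t} (\<lambda>s. (defect_norm (Vh h) (mh h) (ah h) (d s))\<^sup>2))"
proof -
  define i0 i1 where "i0 = Ih h (to_dual j u0)" and "i1 = Ih h (to_dual j u1)"
  define r0 r1 where "r0 = ritz a (Vh h) (ah h) (lft h) u0" and "r1 = ritz a (Vh h) (ah h) (lft h) u1"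
  define w where "w = inv_into (W h) (lft h) u0"
  define \<Delta>n where "\<Delta>n x = sup_quotient (Vh h) (form_norm (ah h)) (delta_form b (bh h) (lft h) x)" for x
  define D where "D x = dual_norm a (blinfun_apply (form_op b) x)" for x
  define \<epsilon> where "\<epsilon> = initial_error j a b (Vh h) (W h) (ah h) (bh h) (lft h) (Ih h) C2 u0 u1"
  define I where "I = integral {0..t} (\<lambda>s. (defect_norm (Vh h) (mh h) (ah h) (d s))\<^sup>2)"
  define A where "A x y = norm (blinfun_apply j (lft h x - y))" for x y
  have \<epsilon>: "\<epsilon> = A i1 u1 + A i0 u0 + A r1 u1 + A r0 u0 + \<Delta>n (r0 - w) + \<Delta>n (i0 - w)
      + C2 * D (lft h r0 - u0) + C2 * D (lft h i0 - u0)"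
    by (simp add: \<epsilon>_def initial_error_def Let_def i0_def i1_def r0_def r1_def w_def \<Delta>n_def D_def A_def)
  note sub = Vh_subspace[of h]
  have T0: "0 \<le> T" using T by simp
  have "0 \<in> {0..T}" using T0 by simp
  then have "uh 0 \<in> Vh h" "uh' 0 \<in> Vh h" using uh unfolding semi_discrete_solution_def by blast+
  \<comment> \<open>The interpolants are the initial values of the semi-discrete solution, which
    lies in \<open>Vh h\<close>.\<close>
  then have i: "i0 \<in> Vh h" "i1 \<in> Vh h"
    using uh unfolding semi_discrete_solution_def i0_def i1_def by metis+
  have r: "r0 \<in> Vh h" "r1 \<in> Vh h" unfolding r0_def r1_def by (rule ritz_in_Vh)+
  have w: "w \<in> W h" "lft h w = u0"
    using lift_bij[of h] unfolding w_def bij_betw_def by (auto intro: inv_into_into f_inv_into_f)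
  have VW: "x \<in> W h" if "x \<in> Vh h" for x using that Vh_subset_W by blast
  have xw: "x - w \<in> W h" "lft h (x - w) = lft h x - u0" if "x \<in> Vh h" for x
    using subspace_diff[OF W_subspace VW[OF that] w(1)]
      lin_on_diff[OF lift_linear W_subspace VW[OF that] w(1)] w(2) by auto
  \<comment> \<open>After lifting, a common element \<open>z\<close> of the continuous space can be
    inserted between \<open>x\<close> and \<open>y\<close>.\<close>
  have diff: "c3 * form_norm (mh h) (x - y) \<le> A x z + A y z"
    if x: "x \<in> Vh h" and y: "y \<in> Vh h" for x y z
  proof -
    have "c3 * form_norm (mh h) (x - y) \<le> norm (blinfun_apply j ((lft h x - z) - (lft h y - z)))"
      using c3(2)[OF subspace_diff[OF sub x y]] lin_on_diff[OF lift_linear_Vh sub x y] by simp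
    also have "\<dots> \<le> A x z + A y z"
      unfolding A_def blinfun.diff_right[of j "lft h x - z"] by (rule norm_triangle_ineq4)
    finally show ?thesis .
  qed
  have A_nonneg: "0 \<le> A x y" for x y by (simp add: A_def)
  obtain B where B: "orthonormal_basis (ah h) (Vh h) B" using Vh_basis by blast
  have \<Delta>n_nonneg: "0 \<le> \<Delta>n (x - w)" if "x \<in> Vh h" for x
    unfolding \<Delta>n_def
    using sup_quotient_nonneg[OF ah_inner sub delta_form_linear lin_on_form_norm_bounded[OF ah_inner B delta_form_linear]]
      xw(1)[OF that] by blast
  have D_nonneg: "0 \<le> C2 * D x" for x
    using dual_norm_form_op_nonneg C2(1) by (simp add: D_def)
  define L where "L = C1 * form_norm (mh h) (i1 - r1)
    + (\<Delta>n (i0 - w) + C2 * D (lft h i0 - u0)) + (\<Delta>n (r0 - w) + C2 * D (lft h r0 - u0))"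
  have i1r1: "i1 - r1 \<in> Vh h" and i0r0: "i0 - r0 \<in> Vh h" using i r subspace_diff[OF sub] by blast+
  have L0: "0 \<le> L"
    using C1(1) form_norm_nonneg[OF mh_inner i1r1] \<Delta>n_nonneg i(1) r(1) D_nonneg
    unfolding L_def by (intro add_nonneg_nonneg) auto
  have L_bound: "\<bar>mh h (i1 - r1) v + bh h (i0 - r0) v\<bar> \<le> L * form_norm (ah h) v" if v: "v \<in> Vh h" for v
  proof -
    have "\<bar>mh h (i1 - r1) v\<bar> \<le> form_norm (mh h) (i1 - r1) * form_norm (mh h) v"
      by (rule inner_on_Cauchy_Schwarz[OF mh_inner sub i1r1 v])
    also have "\<dots> \<le> form_norm (mh h) (i1 - r1) * (C1 * form_norm (ah h) v)"
      by (intro mult_left_mono C1(2) v form_norm_nonneg[OF mh_inner i1r1])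
    finally have m: "\<bar>mh h (i1 - r1) v\<bar> \<le> C1 * form_norm (mh h) (i1 - r1) * form_norm (ah h) v"
      by (simp add: mult_ac)
    \<comment> \<open>Inserting the inverse lift \<open>w\<close> of \<open>u0\<close>, which need
      not lie in \<open>Vh h\<close>, splits the term into the two differences that occur in the
      initial error.\<close>
    have "bh h ((i0 - w) - (r0 - w)) v = bh h (i0 - w) v - bh h (r0 - w) v"
      by (rule lin_on_diff[OF bilin_on_left[OF bh_bilinear v] W_subspace xw(1)[OF i(1)] xw(1)[OF r(1)]])
    then have "bh h (i0 - r0) v = bh h (i0 - w) v - bh h (r0 - w) v" by simp
    moreover have "\<bar>bh h (x - w) v\<bar> \<le> (\<Delta>n (x - w) + C2 * D (lft h x - u0)) * form_norm (ah h) v"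
      if "x \<in> Vh h" for x
      using bh_bound[OF xw(1)[OF that] v C2(2)[OF v]] xw(2)[OF that] by (simp add: \<Delta>n_def D_def)
    from this[OF i(1)] this[OF r(1)]
    have "\<bar>bh h (i0 - w) v - bh h (r0 - w) v\<bar> \<le>
        (\<Delta>n (i0 - w) + C2 * D (lft h i0 - u0)) * form_norm (ah h) v
        + (\<Delta>n (r0 - w) + C2 * D (lft h r0 - u0)) * form_norm (ah h) v"
      by linarith
    ultimately have "\<bar>mh h (i1 - r1) v + bh h (i0 - r0) v\<bar> \<le>
        C1 * form_norm (mh h) (i1 - r1) * form_norm (ah h) v
        + ((\<Delta>n (i0 - w) + C2 * D (lft h i0 - u0)) * form_norm (ah h) v
        + (\<Delta>n (r0 - w) + C2 * D (lft h r0 - u0)) * form_norm (ah h) v)"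
      using m by linarith
    then show ?thesis by (simp add: L_def distrib_right add.assoc)
  qed
  have I0: "0 \<le> I" unfolding I_def using N by (intro integral_nonneg) auto
  define S where "S = sqrt (\<epsilon>\<^sup>2 + T * I)"
  \<comment> \<open>The summands account for the initial position error, the initial velocity error
    measured in the dual norm, and the damping terms of \<open>L\<close>; the final 8 also covers
    the factor of the defect term.\<close>
  define K where "K = 1 / c3 + 8 * C1 / c3 + 8"
  have K0: "0 < K" unfolding K_def using c3(1) C1(1) by (intro add_nonneg_pos) auto
  have nonneg: "0 \<le> A i1 u1" "0 \<le> A i0 u0" "0 \<le> A r1 u1" "0 \<le> A r0 u0" "0 \<le> \<Delta>n (r0 - w)"
      "0 \<le> \<Delta>n (i0 - w)" "0 \<le> C2 * D (lft h r0 - u0)" "0 \<le> C2 * D (lft h i0 - u0)"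
    using A_nonneg \<Delta>n_nonneg i r D_nonneg by auto
  then have \<epsilon>0: "0 \<le> \<epsilon>" unfolding \<epsilon> by linarith
  have "c3 * form_norm (mh h) (i0 - r0) \<le> \<epsilon>" "c3 * form_norm (mh h) (i1 - r1) \<le> \<epsilon>"
    using diff[OF i(1) r(1), of u0] diff[OF i(2) r(2), of u1] nonneg unfolding \<epsilon> by linarith+
  then have e0: "form_norm (mh h) (i0 - r0) \<le> \<epsilon> / c3" and e1: "form_norm (mh h) (i1 - r1) \<le> \<epsilon> / c3"
    using c3(1) by (simp_all add: pos_le_divide_eq mult.commute)
  have "L \<le> C1 * (\<epsilon> / c3) + \<epsilon>"
    using mult_left_mono[OF e1, of C1] C1(1) nonneg unfolding L_def \<epsilon> by linarith
  moreover have "sqrt (t * I) \<le> sqrt (T * I)" using T(2) I0 by (simp add: mult_right_mono)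
  ultimately have "form_norm (mh h) (i0 - r0) + 8 * (L + sqrt (t * I))
      \<le> \<epsilon> / c3 + 8 * ((C1 * (\<epsilon> / c3) + \<epsilon>) + sqrt (T * I))"
    by (intro add_mono mult_left_mono e0) simp_all
  also have "\<dots> = K * \<epsilon> + 8 * sqrt (T * I)" by (simp add: K_def field_simps)
  \<comment> \<open>Both \<open>\<epsilon>\<close> and \<open>sqrt (T * I)\<close> are at most
    \<open>S\<close>; this is the origin of the factor 2 in the final constant.\<close>
  also have "\<dots> \<le> K * S + K * S"
  proof (intro add_mono mult_left_mono mult_mono)
    have TI: "0 \<le> T * I" using T0 I0 by simp
    show "\<epsilon> \<le> S" unfolding S_def using TI by (intro real_le_rsqrt) simp
    show "sqrt (T * I) \<le> S" unfolding S_def by simp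
    show "8 \<le> K" unfolding K_def using c3(1) C1(1) by simp
    show "0 \<le> sqrt (T * I)" using TI by simp
  qed (use K0 in simp_all)
  finally have sum_le: "form_norm (mh h) (i0 - r0) + 8 * (L + sqrt (t * I)) \<le> 2 * K * S" by simp
  define Rt where "Rt = ritz a (Vh h) (ah h) (lft h) (u t)"
  have V: "uh t \<in> Vh h" "Rt \<in> Vh h" "uh t - Rt \<in> Vh h"
    using uh T ritz_in_Vh subspace_diff[OF sub] unfolding semi_discrete_solution_def Rt_def by auto
  have "form_norm (mh h) (uh t - Rt) \<le> exp (\<rho>h * t) * (form_norm (mh h) (i0 - r0) + 8 * (L + sqrt (t * I)))"
    unfolding Rt_def I_def r0_def
    by (rule error_stability[OF T u uh[folded i0_def i1_def] d N L0])
      (use L_bound in \<open>simp add: r0_def r1_def\<close>)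
  also have "\<dots> \<le> exp (\<rho>h * t) * (2 * K * S)" by (intro mult_left_mono sum_le) simp
  also have "\<dots> \<le> exp (\<rho>h * T) * (2 * K * S)"
    using T \<rho>h_nonneg K0 I0 T0 by (intro mult_right_mono) (auto simp: S_def mult_left_mono)
  finally have "C3 * form_norm (mh h) (uh t - Rt) \<le> C3 * (exp (\<rho>h * T) * (2 * K * S))"
    using C3(1) by (intro mult_left_mono) auto
  with C3(2)[OF V(3)] have "norm (blinfun_apply j (lft h (uh t - Rt))) \<le> C3 * (exp (\<rho>h * T) * (2 * K * S))"
    by linarith
  moreover have "blinfun_apply j (u t - lft h (uh t))
      = blinfun_apply j (u t - lft h Rt) - blinfun_apply j (lft h (uh t - Rt))"
    using lin_on_diff[OF lift_linear_Vh sub V(1,2)] by (simp add: blinfun.diff_right)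
  ultimately have "norm (blinfun_apply j (u t - lft h (uh t)))
      \<le> norm (blinfun_apply j (u t - lft h Rt)) + C3 * (exp (\<rho>h * T) * (2 * K * S))"
    using norm_triangle_ineq4[of "blinfun_apply j (u t - lft h Rt)" "blinfun_apply j (lft h (uh t - Rt))"]
    by simp
  then show ?thesis
    by (simp add: Rt_def S_def K_def I_def \<epsilon>_def mult_ac)
qed

end

theorem mainTheorem7:
  fixes j :: "'v::{real_inner, banach} \<Rightarrow>\<^sub>L 'h::{real_inner, banach}"
    and a b :: "'v \<Rightarrow> 'v \<Rightarrow> real"
    and Vh W :: "'i \<Rightarrow> 'x::real_normed_vector set"
    and mh ah bh :: "'i \<Rightarrow> 'x \<Rightarrow> 'x \<Rightarrow> real"
    and \<rho>h :: real
    and lft :: "'i \<Rightarrow> 'x \<Rightarrow> 'v"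
    and Z :: "('v \<Rightarrow>\<^sub>L real) set"
    and Ih :: "'i \<Rightarrow> ('v \<Rightarrow>\<^sub>L real) \<Rightarrow> 'x"
  assumes setting: "semi_discrete_setting j a b Vh W mh ah bh \<rho>h lft Z Ih"
  shows "\<exists>C>0. \<exists>c>0. \<forall>h T f u0 u1 u u' u'' uh uh' uh'' d.
    0 < T \<longrightarrow>
    to_dual j u0 \<in> Z \<longrightarrow> to_dual j u1 \<in> Z \<longrightarrow> (\<forall>t\<in>{0..T}. f t \<in> Z) \<longrightarrow>
    wave_solution j a b T f u0 u1 u u' u'' \<longrightarrow>
    semi_discrete_solution (Vh h) (mh h) (ah h) (bh h) T (\<lambda>t. Ih h (f t))
      (Ih h (to_dual j u0)) (Ih h (to_dual j u1)) uh uh' uh'' \<longrightarrow>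
    is_defect a (Vh h) (mh h) (ah h) (bh h) (lft h) T (\<lambda>t. Ih h (f t)) u u' u'' d \<longrightarrow>
    (\<lambda>s. (defect_norm (Vh h) (mh h) (ah h) (d s))\<^sup>2) integrable_on {0..T} \<longrightarrow>
    (\<forall>t\<in>{0..T}.
       norm (blinfun_apply j (u t - lft h (uh t)))
       \<le> norm (blinfun_apply j (u t - lft h (ritz a (Vh h) (ah h) (lft h) (u t))))
         + C * exp (\<rho>h * T)
           * sqrt ((initial_error j a b (Vh h) (W h) (ah h) (bh h) (lft h) (Ih h) c u0 u1)\<^sup>2
                   + T * integral {0..t} (\<lambda>s. (defect_norm (Vh h) (mh h) (ah h) (d s))\<^sup>2)))"
proof -
  interpret semi_discrete_setting j a b Vh W mh ah bh \<rho>h lft Z Ih by (rule setting)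
  obtain C1 where C1: "0 < C1" "\<And>h v. v \<in> Vh h \<Longrightarrow> form_norm (mh h) v \<le> C1 * form_norm (ah h) v"
    using mh_le_ah by blast
  obtain C2 where C2: "0 < C2" "\<And>h v. v \<in> Vh h \<Longrightarrow> form_norm a (lft h v) \<le> C2 * form_norm (ah h) v"
    using lift_energy_equiv by blast
  obtain c3 C3 where c3: "0 < c3"
      "\<And>h v. v \<in> Vh h \<Longrightarrow> c3 * form_norm (mh h) v \<le> norm (blinfun_apply j (lft h v))"
    and C3: "0 < C3"
      "\<And>h v. v \<in> Vh h \<Longrightarrow> norm (blinfun_apply j (lft h v)) \<le> C3 * form_norm (mh h) v"
    using lift_H_equiv by blast
  have pos: "0 < 2 * C3 * (1 / c3 + 8 * C1 / c3 + 8)"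
    using C1(1) c3(1) C3(1) by (intro mult_pos_pos add_pos_pos) auto
  show ?thesis
  \<comment> \<open>Both witnesses are fixed before \<open>h\<close>, \<open>T\<close> and the data;
    the second one is the upper energy constant \<open>C2\<close> of the lift.\<close>
  proof (rule exI, rule conjI[OF pos], rule exI, rule conjI[OF C2(1)], intro allI impI ballI)
    fix h f u0 u1 u u' u'' uh uh' uh'' d and T t :: real
    assume "(\<lambda>s. (defect_norm (Vh h) (mh h) (ah h) (d s))\<^sup>2) integrable_on {0..T}" "t \<in> {0..T}"
    then have t: "0 \<le> t" "t \<le> T" and "{0..t} \<subseteq> {0..T}" and "(\<lambda>s. (defect_norm (Vh h) (mh h) (ah h) (d s))\<^sup>2) integrable_on {0..T}"
      by auto
    then have N: "(\<lambda>s. (defect_norm (Vh h) (mh h) (ah h) (d s))\<^sup>2) integrable_on {0..t}"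
      by (metis integrable_on_subinterval)
    assume u: "wave_solution j a b T f u0 u1 u u' u''"
      and uh: "semi_discrete_solution (Vh h) (mh h) (ah h) (bh h) T (\<lambda>t. Ih h (f t))
        (Ih h (to_dual j u0)) (Ih h (to_dual j u1)) uh uh' uh''"
      and d: "is_defect a (Vh h) (mh h) (ah h) (bh h) (lft h) T (\<lambda>t. Ih h (f t)) u u' u'' d"
    show "norm (blinfun_apply j (u t - lft h (uh t)))
       \<le> norm (blinfun_apply j (u t - lft h (ritz a (Vh h) (ah h) (lft h) (u t))))
         + 2 * C3 * (1 / c3 + 8 * C1 / c3 + 8) * exp (\<rho>h * T)
           * sqrt ((initial_error j a b (Vh h) (W h) (ah h) (bh h) (lft h) (Ih h) C2 u0 u1)\<^sup>2
                   + T * integral {0..t} (\<lambda>s. (defect_norm (Vh h) (mh h) (ah h) (d s))\<^sup>2))"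
      by (rule wave_error_bound[OF C1 C2 c3 C3 t u uh d N])
  qed
qed

end
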